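(* Let $(\Omega,\mathcal F,Q)$ be a probability space, $X$ an $E$-valued random variable on it, $h$ a real-valued measurable function on $E$, and $\psi=\mathbb E_Q[h(X)]$. Let $\mathcal P$ be a class of probability measures on $(\Omega,\mathcal F)$ (the proposal distributions) such that: (i) for every $P\in\mathcal P$ and every event $A\in\mathcal F$, $P(A)=0$ implies $h(X)=0$ on $A$, $Q$-almost surely; (ii) there are constants $r>1$ and $C>0$ such that for every $P\in\mathcal P$, $$\left(\mathbb E_P\left[\left|h(X)\tfrac{dQ}{dP}(X)\right|^r\right]\right)^{1/r}<C .$$ Let $\hat\psi_k$ be the flat-AMIS estimator with proposals $P_1,P_2,\ldots\in\mathcal P$ and sample sizes $N_1,N_2,\ldots$, that is, $$\hat\psi_k=\frac{1}{\sum_{l=1}^k N_l}\sum_{l=1}^k\sum_{n=1}^{N_l} h(X_n^l)\,\tfrac{dQ}{dP_l}(X_n^l),$$ where the samples $X_n^l$ are generated by the adaptive sampling scheme described in the context. Then $$\hat\psi_k\to\psi\quad\text{almost surely, when } \sum_{l\le k}N_l\to\infty .$$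
   Context: Density convention: for $P\in\mathcal P$, $\frac{dQ}{dP}$ denotes a density of $Q$ relative to $P$, regarded as a function of the value of $X$; it is only required to exist where $h\neq 0$. That is, for every measurable $B\subseteq\{x\in E: h(x)\ne 0\}$, $Q(X\in B)=\mathbb E_P\left[\mathbf 1_{\{X\in B\}}\tfrac{dQ}{dP}(X)\right]$; where $h=0$ the product $h\,\frac{dQ}{dP}$ is read as $0$. Adaptive Multiple Importance Sampling (AMIS) with flat re-weighting: $N_1,N_2,\ldots$ are given (non-random) sample sizes. At iteration $k=1,2,\ldots$: (1) Adaptation: a proposal $P_k\in\mathcal P$ is constructed, possibly depending (measurably) on all samples $X_n^l$, $1\le l<k$, $1\le n\le N_l$, drawn in earlier iterations; the dependence is otherwise arbitrary, and is such that the resulting weights $h(X_n^k)\frac{dQ}{dP_k}(X_n^k)$ are random variables. (2) Generation: given all earlier samples, $X_1^k,\ldots,X_{N_k}^k$ are drawn independently with $X_n^k\sim P_k$, i.e. each has conditionally the law of $X$ under $P_k$. (3) Flat re-weighting: all re-weighting factors are $w_n^l=1$. (4) Output: $\hat\psi_k$ as in the claim. No relation between the growth of $N_k$ and $k$ is assumed. "Almost surely" is with respect to the joint law of all samples. *)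

theory Defs
  imports "HOL-Probability.Probability"
begin

text \<open>
  The measure \<^term>\<open>Q\<close> carries the measurable space of the underlying experiment, \<^term>\<open>E\<close> is the
  state space, \<^term>\<open>X\<close> the random element and \<^term>\<open>h\<close> the integrand.  A density of \<^term>\<open>Q\<close> relative
  to \<^term>\<open>P\<close> is a function \<^term>\<open>d\<close> of the value of \<^term>\<open>X\<close> that is constrained only where
  \<^term>\<open>h\<close> does not vanish.  The integrability clause says that the expectation on the right-hand side
  exists (a Bochner integral would otherwise be \<^term>\<open>0::real\<close>).  Non-negativity of \<^term>\<open>d\<close> is
  not demanded pointwise; it follows almost surely.
\<close>

definition density_off_zeros ::
  "'a measure \<Rightarrow> 'e measure \<Rightarrow> ('a \<Rightarrow> 'e) \<Rightarrow> ('e \<Rightarrow> real) \<Rightarrow> 'a measure \<Rightarrow> ('e \<Rightarrow> real) \<Rightarrow> bool"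
  where
  "density_off_zeros Q E X h P d \<longleftrightarrow>
     d \<in> borel_measurable (restrict_space E {x. h x \<noteq> 0}) \<and>
     (\<forall>B\<in>sets E. B \<subseteq> {x. h x \<noteq> 0} \<longrightarrow>
        integrable P (\<lambda>\<omega>. indicator B (X \<omega>) * d (X \<omega>)) \<and>
        measure Q (X -` B \<inter> space Q) = (\<integral>\<omega>. indicator B (X \<omega>) * d (X \<omega>) \<partial>P))"

text \<open>
  The pair \<open>(l, n)\<close> is the index of the \<open>n\<close>-th sample of iteration \<open>l\<close>; both counts start at one.
  An array of samples is an element \<^term>\<open>x\<close> of the product of copies of \<^term>\<open>E\<close> over these indices.
\<close>

definition sample_indices :: "(nat \<Rightarrow> nat) \<Rightarrow> (nat \<times> nat) set" where
  "sample_indices N = (SIGMA l:{1..}. {1..N l})"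

definition earlier_indices :: "(nat \<Rightarrow> nat) \<Rightarrow> nat \<Rightarrow> (nat \<times> nat) set" where
  "earlier_indices N k = (SIGMA l:{1..<k}. {1..N l})"

definition earlier_samples ::
  "(nat \<Rightarrow> nat) \<Rightarrow> nat \<Rightarrow> (nat \<times> nat \<Rightarrow> 'e) \<Rightarrow> (nat \<times> nat \<Rightarrow> 'e)" where
  "earlier_samples N k x = restrict x (earlier_indices N k)"

definition earlier_space :: "(nat \<Rightarrow> nat) \<Rightarrow> 'e measure \<Rightarrow> nat \<Rightarrow> (nat \<times> nat \<Rightarrow> 'e) measure" where
  "earlier_space N E k = PiM (earlier_indices N k) (\<lambda>_. E)"

text \<open>
  \<open>Prop k y\<close> is the proposal of iteration \<open>k\<close> when the array of earlier samples is \<open>y\<close>, and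
  \<open>J\<close> is the joint law of all samples.  Measurable dependence is that of a Markov kernel, with
  respect to \<^const>\<open>prob_algebra\<close>.  The last clause says that, conditionally on the sigma-algebra
  generated by the earlier samples, the samples of iteration \<open>k\<close> are independent, each with the law
  of \<^term>\<open>X\<close> under the current proposal.
\<close>

definition adaptive_sampling ::
  "'a measure \<Rightarrow> 'e measure \<Rightarrow> ('a \<Rightarrow> 'e) \<Rightarrow> 'a measure set \<Rightarrow> (nat \<Rightarrow> nat) \<Rightarrow>
   (nat \<Rightarrow> (nat \<times> nat \<Rightarrow> 'e) \<Rightarrow> 'a measure) \<Rightarrow> (nat \<times> nat \<Rightarrow> 'e) measure \<Rightarrow> bool" where
  "adaptive_sampling Q E X \<P> N Prop J \<longleftrightarrow>
     prob_space J \<and> sets J = sets (PiM (sample_indices N) (\<lambda>_. E)) \<and>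
     (\<forall>k\<ge>1.
        Prop k \<in> earlier_space N E k \<rightarrow>\<^sub>M prob_algebra Q \<and>
        (\<forall>y\<in>space (earlier_space N E k). Prop k y \<in> \<P>) \<and>
        (\<forall>B. (\<forall>n\<in>{1..N k}. B n \<in> sets E) \<longrightarrow>
           (AE x in J.
              real_cond_exp J (vimage_algebra (space J) (earlier_samples N k) (earlier_space N E k))
                (indicator {x \<in> space J. \<forall>n\<in>{1..N k}. x (k, n) \<in> B n}) x
              = (\<Prod>n=1..N k. measure (Prop k (earlier_samples N k x)) (X -` B n \<inter> space Q)))))"

definition amis_weight ::
  "('e \<Rightarrow> real) \<Rightarrow> ('a measure \<Rightarrow> 'e \<Rightarrow> real) \<Rightarrow> (nat \<Rightarrow> nat) \<Rightarrow>
   (nat \<Rightarrow> (nat \<times> nat \<Rightarrow> 'e) \<Rightarrow> 'a measure) \<Rightarrow> nat \<Rightarrow> nat \<Rightarrow> (nat \<times> nat \<Rightarrow> 'e) \<Rightarrow> real" where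
  "amis_weight h dens N Prop l n x = h (x (l, n)) * dens (Prop l (earlier_samples N l x)) (x (l, n))"

definition flat_amis_estimator ::
  "('e \<Rightarrow> real) \<Rightarrow> ('a measure \<Rightarrow> 'e \<Rightarrow> real) \<Rightarrow> (nat \<Rightarrow> nat) \<Rightarrow>
   (nat \<Rightarrow> (nat \<times> nat \<Rightarrow> 'e) \<Rightarrow> 'a measure) \<Rightarrow> nat \<Rightarrow> (nat \<times> nat \<Rightarrow> 'e) \<Rightarrow> real" where
  "flat_amis_estimator h dens N Prop k x =
     1 / real (\<Sum>l=1..k. N l) * (\<Sum>l=1..k. \<Sum>n=1..N l. amis_weight h dens N Prop l n x)"

end

theory Submission
  imports Defs
begin

text \<open>
Enumerate the samples in the order in which they are generated, batch after batch.  Given everything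
drawn before, the next sample is drawn from a proposal \<open>P\<close> that the past has fixed, so its weight
has conditional mean \<open>\<integral> h(X) dens(X) dP = \<integral> h(X) dQ = \<psi>\<close>, whatever \<open>P\<close> is
(\<open>density_off_zeros_change_of_measure\<close>), and its conditional \<open>r\<close>-th absolute moment is below \<open>C powr r\<close>.  The
weights minus \<open>\<psi>\<close> are martingale differences with bounded moments of an order above one, and their
averages tend to zero almost surely.  The estimator is this average read off at the ends of the batches.  As
the law of large numbers holds along all positions, the sizes of the batches do not matter; only
their sum has to be unbounded.

Two points carry the weight of the proof.  The first is the passage from the batchwise
description of the sampling scheme to single samples (\<open>adaptive_sampling_one_step\<close>) and from there to
conditional expectations of functions of the next weight (\<open>cond_exp_one_step\<close>, \<open>cond_exp_weight\<close>).

The second is the strong law itself (\<open>strong_law_nonneg_adapted\<close>).  Variances need not exist when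
\<open>r < 2\<close>, so the variables are truncated, and martingale convergence theorems and maximal inequalities
are avoided by Etemadi's device: for non-negative variables it is enough to treat a
subsequence with ratios tending to one.  The weights are therefore split into positive and negative parts.
Unlike the weights, the parts have conditional means that depend on the chosen proposal; the
strong law subtracts these random means, which are uniformly bounded, and only the difference of the
two parts brings back the constant \<open>\<psi>\<close>.
\<close>

section \<open>A strong law for adapted non-negative variables\<close>

text \<open>
The sequence \<open>a\<close> may rise freely but falls by at most \<open>B\<close> per step.  Between two consecutive points of
the subsequence it is therefore trapped between their values, up to \<open>B\<close> times their gap, and the
ratio condition makes the gap negligible.  This one-sided control replaces a maximal inequality.
\<close>

lemma tendsto_zero_from_slow_subsequence:
  fixes a :: "nat \<Rightarrow> real" and \<nu> :: "nat \<Rightarrow> nat"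
  assumes mono: "mono (\<lambda>n. a n + B * real n)" and "0 \<le> B"
    and \<nu>: "strict_mono \<nu>" "0 < \<nu> 0"
    and lim: "(\<lambda>i. a (\<nu> i) / real (\<nu> i)) \<longlonglongrightarrow> 0"
    and ratio: "(\<lambda>i. real (\<nu> (Suc i)) / real (\<nu> i)) \<longlonglongrightarrow> 1"
  shows "(\<lambda>n. a n / real n) \<longlonglongrightarrow> 0"
proof -
  \<comment> \<open>\<open>\<beta> i\<close> bounds \<open>\<bar>a n / real n\<bar>\<close> for all \<open>n\<close> in the gap between \<open>\<nu> i\<close> and \<open>\<nu> (Suc i)\<close>.\<close>
  define \<beta> where "\<beta> i = \<bar>a (\<nu> i) / real (\<nu> i)\<bar>
      + \<bar>a (\<nu> (Suc i)) / real (\<nu> (Suc i))\<bar> * (real (\<nu> (Suc i)) / real (\<nu> i))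
      + B * (real (\<nu> (Suc i)) / real (\<nu> i) - 1)" for i
  have "\<beta> \<longlonglongrightarrow> \<bar>0\<bar> + \<bar>0\<bar> * 1 + B * (1 - 1)"
    unfolding \<beta>_def by (intro tendsto_intros lim ratio LIMSEQ_Suc[OF lim])
  then have \<beta>: "\<beta> \<longlonglongrightarrow> 0" by simp
  have pos: "0 < \<nu> i" for i
    using \<nu> by (metis gr0I gr_implies_not0 strict_mono_less_eq zero_le leD)
  have key: "\<bar>a n / real n\<bar> \<le> \<beta> i" if n: "\<nu> i \<le> n" "n \<le> \<nu> (Suc i)" for n i
  proof -
    let ?u = "real (\<nu> i)" and ?v = "real (\<nu> (Suc i))"
    have uv: "0 < ?u" "0 < ?v" "?u \<le> real n" "real n \<le> ?v"
      using pos n by auto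
    have eq: "?u * \<beta> i = \<bar>a (\<nu> i)\<bar> + \<bar>a (\<nu> (Suc i))\<bar> + B * (?v - ?u)"
      using uv unfolding \<beta>_def by (simp add: field_simps)
    have lo: "a (\<nu> i) + B * ?u \<le> a n + B * real n"
      and up: "a n + B * real n \<le> a (\<nu> (Suc i)) + B * ?v"
      using monoD[OF mono n(1)] monoD[OF mono n(2)] by auto
    have "B * ?u \<le> B * real n" "B * real n \<le> B * ?v"
      using uv \<open>0 \<le> B\<close> by (auto intro: mult_left_mono)
    then have "\<bar>a n\<bar> \<le> ?u * \<beta> i"
      unfolding eq using lo up by (simp add: abs_le_iff algebra_simps)
    moreover have "0 \<le> \<beta> i"
      using uv \<open>0 \<le> B\<close> by (auto simp: \<beta>_def intro!: add_nonneg_nonneg mult_nonneg_nonneg)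
    ultimately have "\<bar>a n\<bar> \<le> real n * \<beta> i"
      using uv by (meson mult_right_mono order_trans)
    then show ?thesis
      using uv by (simp add: abs_divide divide_le_eq mult.commute)
  qed
  have bracket: "\<exists>i\<ge>i0. \<nu> i \<le> n \<and> n \<le> \<nu> (Suc i)" if "\<nu> i0 \<le> n" for i0 n
  proof -
    let ?P = "\<lambda>i. \<nu> i \<le> n"
    have bd: "i \<le> n" if "?P i" for i
      using strict_mono_imp_increasing[OF \<nu>(1), of i] that by (rule order_trans)
    have 1: "?P (Greatest ?P)"
      using that bd by (rule GreatestI_nat)
    have 2: "i0 \<le> Greatest ?P"
      using that bd by (rule Greatest_le_nat)
    have 3: "\<not> ?P (Suc (Greatest ?P))"
    proof
      assume "?P (Suc (Greatest ?P))"
      then have "Suc (Greatest ?P) \<le> Greatest ?P" using bd by (rule Greatest_le_nat)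
      then show False by simp
    qed
    show ?thesis
      using 1 2 3 by (intro exI[of _ "Greatest ?P"] conjI) simp_all
  qed
  show ?thesis
  proof (rule LIMSEQ_I)
    fix e :: real assume "0 < e"
    with \<beta> obtain i0 where i0: "\<And>i. i \<ge> i0 \<Longrightarrow> \<beta> i < e"
      by (metis LIMSEQ_D abs_less_iff diff_zero real_norm_def)
    show "\<exists>n0. \<forall>n\<ge>n0. norm (a n / real n - 0) < e"
    proof (intro exI allI impI)
      fix n assume "\<nu> i0 \<le> n"
      then obtain i where "i \<ge> i0" "\<nu> i \<le> n" "n \<le> \<nu> (Suc i)" using bracket by blast
      then show "norm (a n / real n - 0) < e" using key i0 by fastforce
    qed
  qed
qed

text \<open>
By monotone convergence the series of the \<open>f i\<close> has finite expectation, so it converges almost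
surely, and its terms tend to zero.  This plays the part of Chebyshev's inequality and the Borel-Cantelli
lemma together, without the detour through probabilities of deviations.
\<close>

lemma AE_tendsto_zero_if_summable_integrals:
  fixes f :: "nat \<Rightarrow> 'a \<Rightarrow> real"
  assumes int: "\<And>i. integrable M (f i)" and nn: "\<And>i. AE x in M. 0 \<le> f i x"
    and le: "\<And>i. (\<integral>x. f i x \<partial>M) \<le> c i" and c: "summable c"
  shows "AE x in M. (\<lambda>i. f i x) \<longlonglongrightarrow> 0"
proof -
  have [measurable]: "f i \<in> borel_measurable M" for i using int by auto
  have c0: "0 \<le> c i" for i
    using le[of i] integral_nonneg_AE[OF nn[of i]] by linarith
  have "(\<integral>\<^sup>+x. (\<Sum>i. ennreal (f i x)) \<partial>M) = (\<Sum>i. \<integral>\<^sup>+x. ennreal (f i x) \<partial>M)"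
    by (rule nn_integral_suminf) simp
  also have "\<dots> = (\<Sum>i. ennreal (\<integral>x. f i x \<partial>M))"
    using int nn by (simp add: nn_integral_eq_integral)
  also have "\<dots> \<le> (\<Sum>i. ennreal (c i))"
    by (intro suminf_le ennreal_leI le) auto
  also have "\<dots> < \<infinity>"
    using c c0 by (simp add: suminf_ennreal2)
  finally have "AE x in M. (\<Sum>i. ennreal (f i x)) \<noteq> \<infinity>"
    by (intro nn_integral_PInf_AE) auto
  moreover have "AE x in M. \<forall>i. 0 \<le> f i x"
    using nn by (simp add: AE_all_countable)
  ultimately show ?thesis
  proof eventually_elim
    case (elim x)
    then have "summable (\<lambda>i. f i x)"
      by (intro summable_suminf_not_top) auto
    then show ?case by (rule summable_LIMSEQ_zero)
  qed
qed

text \<open>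
A filtration is indexed by the number of observations made so far: the \<open>j\<close>-th observation, counted from
zero, is known to \<open>F (Suc j)\<close> and is predicted from \<open>F j\<close>.
\<close>

locale filtered_prob_space = prob_space M for M :: "'a measure" +
  fixes F :: "nat \<Rightarrow> 'a measure"
  assumes subalgebra_F: "\<And>n. subalgebra M (F n)"
    and mono_F: "\<And>m n. m \<le> n \<Longrightarrow> sets (F m) \<subseteq> sets (F n)"
begin

lemma finite_measure_subalgebra_F: "finite_measure_subalgebra M (F n)"
  by (simp add: finite_measure_subalgebra_def finite_measure_subalgebra_axioms_def
      finite_measure_axioms subalgebra_F)

lemma measurable_mono_F: "f \<in> borel_measurable (F m) \<Longrightarrow> m \<le> n \<Longrightarrow> f \<in> borel_measurable (F n)"
  by (rule measurable_from_subalg[of "F n" "F m"])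
     (use mono_F subalgebra_F in \<open>auto simp: subalgebra_def\<close>)

lemma measurable_F_M: "f \<in> borel_measurable (F m) \<Longrightarrow> f \<in> borel_measurable M"
  by (rule measurable_from_subalg[OF subalgebra_F])

text \<open>
Martingale differences are orthogonal: the partial sum \<open>S\<close> up to \<open>n\<close> is known to \<open>F n\<close>, so it has the
same integral against the \<open>n\<close>-th term as against its conditional expectation.  Centring
cannot increase a second moment.  Boundedness of \<open>Z\<close> makes every product integrable.
\<close>

lemma second_moment_centered_sum:
  assumes Z: "\<And>j. Z j \<in> borel_measurable (F (Suc j))" and bd: "\<And>j x. \<bar>Z j x\<bar> \<le> c"
  shows "integrable M (\<lambda>x. (\<Sum>j<n. Z j x - real_cond_exp M (F j) (Z j) x)\<^sup>2)"
    and "(\<integral>x. (\<Sum>j<n. Z j x - real_cond_exp M (F j) (Z j) x)\<^sup>2 \<partial>M)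
     \<le> (\<Sum>j<n. \<integral>x. (Z j x)\<^sup>2 \<partial>M)"
proof -
  define R where "R j = real_cond_exp M (F j) (Z j)" for j
  define S where "S n x = (\<Sum>j<n. Z j x - R j x)" for n x
  have ZM [measurable]: "Z j \<in> borel_measurable M" for j
    by (rule measurable_F_M[OF Z])
  have Zint [simp]: "integrable M (Z j)" for j
    by (rule integrable_const_bound[where B=c]) (use bd in auto)
  have RF: "R j \<in> borel_measurable (F j)" for j
    unfolding R_def by simp
  have RM [measurable]: "R j \<in> borel_measurable M" for j
    by (rule measurable_F_M[OF RF])
  have SF: "S n \<in> borel_measurable (F n)" for n
    unfolding S_def
    by (intro borel_measurable_sum borel_measurable_diff measurable_mono_F[OF Z]
        measurable_mono_F[OF RF]) auto
  have SM [measurable]: "S n \<in> borel_measurable M" for n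
    by (rule measurable_F_M[OF SF])
  have c0: "0 \<le> c" using bd[of 0 undefined] by linarith
  have Rbd: "AE x in M. \<bar>R j x\<bar> \<le> c" for j
  proof -
    interpret finite_measure_subalgebra M "F j" by (rule finite_measure_subalgebra_F)
    have "AE x in M. - c \<le> Z j x" "AE x in M. Z j x \<le> c"
      using bd[of j] by (auto simp: abs_le_iff minus_le_iff)
    then have "AE x in M. - c \<le> R j x" "AE x in M. R j x \<le> c"
      unfolding R_def by - (rule real_cond_exp_ge_c[OF Zint], assumption, rule real_cond_exp_le_c[OF Zint], assumption)
    then show ?thesis by eventually_elim auto
  qed
  have Sbd: "AE x in M. \<bar>S n x\<bar> \<le> real n * (2 * c)" for n
  proof -
    have "AE x in M. \<forall>j. \<bar>R j x\<bar> \<le> c" using Rbd by (simp add: AE_all_countable)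
    then show ?thesis
    proof eventually_elim
      case (elim x)
      have "\<bar>Z j x - R j x\<bar> \<le> 2 * c" for j
        using elim[rule_format, of j] bd[of j x] by linarith
      then have "(\<Sum>j<n. \<bar>Z j x - R j x\<bar>) \<le> real n * (2 * c)"
        using sum_bounded_above[of "{..<n}" "\<lambda>j. \<bar>Z j x - R j x\<bar>" "2 * c"] by simp
      then show ?case unfolding S_def by (rule order_trans[OF sum_abs])
    qed
  qed
  have prod_int: "integrable M (\<lambda>x. f x * g x)"
    if [measurable]: "f \<in> borel_measurable M" "g \<in> borel_measurable M"
      and f: "AE x in M. \<bar>f x\<bar> \<le> u" and g: "AE x in M. \<bar>g x\<bar> \<le> v" for f g :: "'a \<Rightarrow> real" and u v
  proof (rule integrable_const_bound[where B="u * v"])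
    show "AE x in M. norm (f x * g x) \<le> u * v"
      using f g by eventually_elim (auto simp: abs_mult intro!: mult_mono)
  qed simp
  have Zbd: "AE x in M. \<bar>Z j x\<bar> \<le> c" for j using bd by simp
  have "integrable M (\<lambda>x. (S n x)\<^sup>2) \<and> (\<integral>x. (S n x)\<^sup>2 \<partial>M) \<le> (\<Sum>j<n. \<integral>x. (Z j x)\<^sup>2 \<partial>M)"
  proof (induction n)
    case 0
    then show ?case by (simp add: S_def)
  next
    case (Suc n)
    interpret Fn: finite_measure_subalgebra M "F n" by (rule finite_measure_subalgebra_F)
    note I = prod_int[OF SM SM Sbd Sbd, of n n] prod_int[OF SM ZM Sbd Zbd, of n n]
      prod_int[OF SM RM Sbd Rbd, of n n] prod_int[OF ZM ZM Zbd Zbd, of n n]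
      prod_int[OF RM ZM Rbd Zbd, of n n] prod_int[OF RM RM Rbd Rbd, of n n]
    have eq: "(S (Suc n) x)\<^sup>2 = S n x * S n x + 2 * (S n x * Z n x) - 2 * (S n x * R n x)
        + Z n x * Z n x - 2 * (R n x * Z n x) + R n x * R n x" for x
      by (simp add: S_def power2_eq_square algebra_simps)
    have "integrable M (\<lambda>x. (S (Suc n) x)\<^sup>2)"
      unfolding eq using I by auto
    moreover have "(\<integral>x. (S (Suc n) x)\<^sup>2 \<partial>M) = (\<integral>x. S n x * S n x \<partial>M) + 2 * (\<integral>x. S n x * Z n x \<partial>M)
        - 2 * (\<integral>x. S n x * R n x \<partial>M) + (\<integral>x. Z n x * Z n x \<partial>M) - 2 * (\<integral>x. R n x * Z n x \<partial>M)
        + (\<integral>x. R n x * R n x \<partial>M)"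
      unfolding eq using I by simp
    moreover have "(\<integral>x. S n x * R n x \<partial>M) = (\<integral>x. S n x * Z n x \<partial>M)"
      unfolding R_def by (rule Fn.real_cond_exp_intg(2)) (use I SF in auto)
    moreover have "(\<integral>x. R n x * R n x \<partial>M) = (\<integral>x. R n x * Z n x \<partial>M)"
      using Fn.real_cond_exp_intg(2)[of "R n" "Z n"] I RF by (simp add: R_def)
    moreover have "0 \<le> (\<integral>x. R n x * R n x \<partial>M)" by simp
    ultimately show ?case
      using Suc by (auto simp: power2_eq_square)
  qed
  then show "integrable M (\<lambda>x. (\<Sum>j<n. Z j x - real_cond_exp M (F j) (Z j) x)\<^sup>2)"
    and "(\<integral>x. (\<Sum>j<n. Z j x - real_cond_exp M (F j) (Z j) x)\<^sup>2 \<partial>M)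
     \<le> (\<Sum>j<n. \<integral>x. (Z j x)\<^sup>2 \<partial>M)"
    by (simp_all add: S_def R_def)
qed

end

text \<open>
Interpolation between powers.  The excess is positive only if \<open>w > c\<close>, and then the factor
\<open>w powr (1 - s)\<close>, of negative exponent, is below its value at \<open>c\<close>.  The truncated value is at most \<open>c\<close>, so its
power of exponent \<open>2 - s\<close> is bounded by that of \<open>c\<close>.
\<close>

lemma truncation_bounds:
  fixes w c s :: real
  assumes "0 \<le> w" "0 < c" "1 < s" "s \<le> 2"
  shows "w - min w c \<le> c powr (1 - s) * w powr s"
    and "(min w c)\<^sup>2 \<le> c powr (2 - s) * w powr s"
proof -
  show "w - min w c \<le> c powr (1 - s) * w powr s"
  proof (cases "w \<le> c")
    case False
    then have "w = w powr (1 - s) * w powr s"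
      using assms by (simp add: powr_add[symmetric])
    also have "\<dots> \<le> c powr (1 - s) * w powr s"
      using assms False by (intro mult_right_mono powr_mono2') auto
    finally show ?thesis using assms False by simp
  qed (use assms in simp)
  show "(min w c)\<^sup>2 \<le> c powr (2 - s) * w powr s"
  proof (cases "w = 0")
    case False
    define m where "m = min w c"
    have m: "0 < m" "m \<le> w" "m \<le> c" using assms False by (auto simp: m_def)
    have "m\<^sup>2 = m powr (2 - s) * m powr s"
      using m by (simp add: powr_add[symmetric])
    also have "\<dots> \<le> c powr (2 - s) * w powr s"
      using m assms by (intro mult_mono powr_mono2) auto
    finally show ?thesis by (simp add: m_def)
  qed (use assms in simp)
qed

lemma le_one_plus_powr:
  fixes w s t :: real
  assumes "0 \<le> w" "0 \<le> s" "s \<le> t"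
  shows "w powr s \<le> 1 + w powr t"
proof (cases "w \<le> 1")
  case True
  then have "w powr s \<le> 1" using assms by (simp add: powr_le1)
  then show ?thesis by (meson add_increasing2 powr_ge_zero)
next
  case False
  then have "w powr s \<le> w powr t" using assms by (intro powr_mono) auto
  then show ?thesis by simp
qed

context filtered_prob_space
begin

text \<open>
Etemadi's proof of the strong law, with conditional instead of plain expectations.  For each \<open>n\<close> the
first \<open>n\<close> variables are truncated at level \<open>n\<close>.  The truncated and centred sum, divided by \<open>n\<close>, has
second moment at most \<open>K * n powr (1 - s)\<close> by orthogonality, and the excess over the level has mean of the
same order.  Along \<open>(i + 1) ^ p\<close> with \<open>p * (s - 1) \<ge> 2\<close> both bounds are summable, so the averages
tend to zero almost surely there.  Since the variables are non-negative and their conditional means are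
at most \<open>B\<close>, the centred sum falls by at most \<open>B\<close> per step, which fills the gaps.
\<close>

theorem strong_law_nonneg_adapted:
  assumes W: "\<And>j. W j \<in> borel_measurable (F (Suc j))" and nn: "\<And>j x. 0 \<le> W j x"
    and s: "1 < s" "s \<le> 2"
    and int: "\<And>j. integrable M (\<lambda>x. W j x powr s)"
    and mom: "\<And>j. (\<integral>x. W j x powr s \<partial>M) \<le> K"
    and cond: "\<And>j. AE x in M. real_cond_exp M (F j) (W j) x \<le> B" and "0 \<le> B"
  shows "AE x in M. (\<lambda>n. (\<Sum>j<n. W j x - real_cond_exp M (F j) (W j) x) / real n) \<longlonglongrightarrow> 0"
proof -
  define E where "E j = real_cond_exp M (F j)" for j
  \<comment> \<open>\<open>Z\<close> is the variable truncated at \<open>c\<close> and \<open>V\<close> the excess; \<open>T n\<close> is the centred average of the truncated variables and \<open>G n\<close> dominates that of the excesses.\<close>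
  define Z where "Z c j x = min (W j x) c" for c :: real and j x
  define V where "V c j x = W j x - Z c j x" for c j x
  define a where "a n x = (\<Sum>j<n. W j x - E j (W j) x)" for n x
  define T where "T n x = (\<Sum>j<n. Z n j x - E j (Z n j) x) / real n" for n :: nat and x
  define G where "G n x = (\<Sum>j<n. V n j x + E j (V n j) x) / real n" for n :: nat and x
  have WM [measurable]: "W j \<in> borel_measurable M" for j
    by (rule measurable_F_M[OF W])
  have ZM [measurable]: "Z c j \<in> borel_measurable M" for c j
    unfolding Z_def by measurable
  have VM [measurable]: "V c j \<in> borel_measurable M" for c j
    unfolding V_def by measurable
  have EM [measurable]: "E j f \<in> borel_measurable M" for j f
    unfolding E_def by (rule measurable_F_M[of _ j]) simp
  have Wint: "integrable M (W j)" for j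
  proof (rule Bochner_Integration.integrable_bound)
    show "integrable M (\<lambda>x. 1 + W j x powr s)" using int by simp
    show "AE x in M. norm (W j x) \<le> norm (1 + W j x powr s)"
    proof (rule AE_I2)
      fix x
      have "W j x powr 1 \<le> 1 + W j x powr s"
        using nn s by (intro le_one_plus_powr) auto
      then show "norm (W j x) \<le> norm (1 + W j x powr s)"
        using nn[of j x] by simp
    qed
  qed simp
  have Zint: "integrable M (Z c j)" if "0 \<le> c" for c j
    by (rule Bochner_Integration.integrable_bound[OF Wint[of j]])
       (use nn[of j] that in \<open>auto simp: Z_def min_def\<close>)
  have Vint: "integrable M (V c j)" if "0 \<le> c" for c j
    unfolding V_def using Wint Zint[OF that] by simp
  have V0: "0 \<le> V c j x" for c j x by (simp add: V_def Z_def)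
  have condE: "AE x in M. \<forall>j. 0 \<le> E j (W j) x \<and> E j (W j) x \<le> B \<and>
      (\<forall>n::nat. 0 \<le> E j (V n j) x \<and> E j (W j) x = E j (Z n j) x + E j (V n j) x)"
  proof -
    have "AE x in M. 0 \<le> E j (W j) x \<and> E j (W j) x \<le> B \<and>
      (\<forall>n::nat. 0 \<le> E j (V n j) x \<and> E j (W j) x = E j (Z n j) x + E j (V n j) x)" for j
    proof -
      interpret finite_measure_subalgebra M "F j" by (rule finite_measure_subalgebra_F)
      have "AE x in M. 0 \<le> E j (W j) x"
        unfolding E_def by (rule real_cond_exp_pos) (use nn in auto)
      moreover have "AE x in M. \<forall>n::nat. 0 \<le> E j (V n j) x"
        unfolding E_def AE_all_countable by (intro allI real_cond_exp_pos) (use V0 in auto)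
      moreover have "AE x in M. \<forall>n::nat. E j (\<lambda>x. Z n j x + V n j x) x = E j (Z n j) x + E j (V n j) x"
        unfolding E_def AE_all_countable by (intro allI real_cond_exp_add Zint Vint) auto
      moreover have "(\<lambda>x. Z n j x + V n j x) = W j" for n by (simp add: V_def)
      moreover have "AE x in M. E j (W j) x \<le> B"
        using cond by (simp add: E_def)
      ultimately show ?thesis
        by (simp add: eventually_conj_iff AE_all_countable)
    qed
    then show ?thesis by (simp add: AE_all_countable)
  qed
  have Tint: "integrable M (\<lambda>x. (T n x)\<^sup>2)" and Tle: "n > 0 \<Longrightarrow> (\<integral>x. (T n x)\<^sup>2 \<partial>M) \<le> K * real n powr (1 - s)" for n
  proof -
    let ?S = "\<lambda>x. \<Sum>j<n. Z n j x - E j (Z n j) x"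
    have "Z n j \<in> borel_measurable (F (Suc j))" for j
      unfolding Z_def by (intro borel_measurable_min W) simp
    moreover have "\<bar>Z n j x\<bar> \<le> real n" for j x
      using nn[of j x] by (simp add: Z_def)
    ultimately have S: "integrable M (\<lambda>x. (?S x)\<^sup>2)"
      "(\<integral>x. (?S x)\<^sup>2 \<partial>M) \<le> (\<Sum>j<n. \<integral>x. (Z n j x)\<^sup>2 \<partial>M)"
      unfolding E_def by (rule second_moment_centered_sum)+
    then show "integrable M (\<lambda>x. (T n x)\<^sup>2)"
      by (simp add: T_def power_divide)
    assume "n > 0"
    have "(\<integral>x. (Z n j x)\<^sup>2 \<partial>M) \<le> (\<integral>x. real n powr (2 - s) * W j x powr s \<partial>M)" for j
      by (rule integral_mono_AE', use int in simp)
         (use truncation_bounds(2)[OF nn[of j]] s \<open>n > 0\<close> in \<open>auto simp: Z_def\<close>)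
    also have "\<dots> j \<le> real n powr (2 - s) * K" for j
      using mom by (simp add: mult_left_mono)
    finally have "(\<Sum>j<n. \<integral>x. (Z n j x)\<^sup>2 \<partial>M) \<le> real n * (real n powr (2 - s) * K)"
      using sum_bounded_above[of "{..<n}" "\<lambda>j. \<integral>x. (Z n j x)\<^sup>2 \<partial>M"] by simp
    with S(2) have "(\<integral>x. (?S x)\<^sup>2 \<partial>M) / (real n)\<^sup>2 \<le> real n * (real n powr (2 - s) * K) / (real n)\<^sup>2"
      by (intro divide_right_mono) auto
    also have "\<dots> = K * (real n powr (2 - s) * real n powr (-1))"
      using \<open>n > 0\<close> by (simp add: powr_minus field_simps power2_eq_square)
    also have "real n powr (2 - s) * real n powr (-1) = real n powr (1 - s)"
      unfolding powr_add[symmetric] by (rule arg_cong[where f="\<lambda>t. real n powr t"]) simp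
    finally show "(\<integral>x. (T n x)\<^sup>2 \<partial>M) \<le> K * real n powr (1 - s)"
      by (simp add: T_def power_divide)
  qed
  have Gint: "integrable M (G n)" and Gle: "n > 0 \<Longrightarrow> (\<integral>x. G n x \<partial>M) \<le> 2 * K * real n powr (1 - s)" for n
  proof -
    have EV: "integrable M (E j (V n j))" "(\<integral>x. E j (V n j) x \<partial>M) = (\<integral>x. V n j x \<partial>M)" for j
    proof -
      interpret finite_measure_subalgebra M "F j" by (rule finite_measure_subalgebra_F)
      show "integrable M (E j (V n j))" "(\<integral>x. E j (V n j) x \<partial>M) = (\<integral>x. V n j x \<partial>M)"
        unfolding E_def using real_cond_exp_int[OF Vint] by auto
    qed
    then show "integrable M (G n)" unfolding G_def using Vint by auto
    assume "n > 0"
    have "(\<integral>x. V n j x \<partial>M) \<le> (\<integral>x. real n powr (1 - s) * W j x powr s \<partial>M)" for j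
      by (rule integral_mono_AE', use int in simp)
         (use truncation_bounds(1)[OF nn[of j]] V0 s \<open>n > 0\<close> in \<open>auto simp: V_def Z_def\<close>)
    also have "\<dots> j \<le> real n powr (1 - s) * K" for j
      using mom by (simp add: mult_left_mono)
    finally have Vle: "(\<integral>x. V n j x \<partial>M) \<le> real n powr (1 - s) * K" for j .
    have "(\<integral>x. G n x \<partial>M) = (\<Sum>j<n. 2 * (\<integral>x. V n j x \<partial>M)) / real n"
      unfolding G_def using EV Vint by simp
    also have "\<dots> \<le> (real n * (2 * (real n powr (1 - s) * K))) / real n"
      using sum_bounded_above[of "{..<n}" "\<lambda>j. 2 * (\<integral>x. V n j x \<partial>M)" "2 * (real n powr (1 - s) * K)"] Vle
      by (intro divide_right_mono) auto
    finally show "(\<integral>x. G n x \<partial>M) \<le> 2 * K * real n powr (1 - s)"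
      using \<open>n > 0\<close> by (simp add: mult_ac)
  qed
  \<comment> \<open>A polynomial subsequence is sparse enough for summability, while its consecutive ratios still tend to one.\<close>
  obtain p :: nat where p: "2 \<le> real p * (s - 1)"
    using s reals_Archimedean3[of "s - 1"] by (metis diff_gt_0_iff_gt less_imp_le)
  have p0: "0 < p" using p by (cases p) auto
  define \<nu> where "\<nu> i = (Suc i) ^ p" for i
  have \<nu>: "strict_mono \<nu>" "0 < \<nu> i" for i
    using p0 by (auto simp: \<nu>_def strict_mono_Suc_iff intro!: power_strict_mono)
  have rate: "real (\<nu> i) powr (1 - s) \<le> real (Suc i) powr (-2)" for i
  proof -
    have "real (\<nu> i) powr (1 - s) = real (Suc i) powr (real p * (1 - s))"
      by (simp add: \<nu>_def powr_realpow[symmetric] powr_powr del: of_nat_Suc)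
    also have "\<dots> \<le> real (Suc i) powr (-2)"
      using p by (intro powr_mono) (auto simp: algebra_simps)
    finally show ?thesis .
  qed
  have K0: "0 \<le> K"
    by (rule order_trans[OF _ mom[of 0]]) simp
  have summ: "summable (\<lambda>i. k * real (Suc i) powr (-2))" for k
  proof -
    have "summable (\<lambda>i. real i powr (-2))" by (simp add: summable_real_powr_iff)
    then show ?thesis by (intro summable_mult) (subst summable_Suc_iff[of "\<lambda>i. real i powr (-2)"])
  qed
  have T0: "AE x in M. (\<lambda>i. (T (\<nu> i) x)\<^sup>2) \<longlonglongrightarrow> 0"
  proof (rule AE_tendsto_zero_if_summable_integrals[OF Tint _ _ summ[of K]])
    show "(\<integral>x. (T (\<nu> i) x)\<^sup>2 \<partial>M) \<le> K * real (Suc i) powr (-2)" for i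
      using Tle[OF \<nu>(2)] mult_left_mono[OF rate K0] by (rule order_trans)
  qed simp
  have G0: "AE x in M. (\<lambda>i. G (\<nu> i) x) \<longlonglongrightarrow> 0"
  proof (rule AE_tendsto_zero_if_summable_integrals[OF Gint _ _ summ[of "2 * K"]])
    show "(\<integral>x. G (\<nu> i) x \<partial>M) \<le> 2 * K * real (Suc i) powr (-2)" for i
      using Gle[OF \<nu>(2)] mult_left_mono[OF rate, of "2 * K"] K0 by (meson order_trans mult_nonneg_nonneg zero_le_numeral)
    show "AE x in M. 0 \<le> G (\<nu> i) x" for i
      using condE by eventually_elim (auto simp: G_def V0 intro!: divide_nonneg_nonneg sum_nonneg add_nonneg_nonneg)
  qed
  have ratio: "(\<lambda>i. real (\<nu> (Suc i)) / real (\<nu> i)) \<longlonglongrightarrow> 1"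
  proof -
    have "(\<lambda>i. (real (Suc (Suc i)) / real (Suc i)) ^ p) \<longlonglongrightarrow> 1 ^ p"
      by (intro tendsto_power LIMSEQ_Suc LIMSEQ_Suc_n_over_n)
    then show ?thesis by (simp add: \<nu>_def power_divide)
  qed
  show ?thesis
    using T0 G0 condE
  proof eventually_elim
    case (elim x)
    have "(\<lambda>i. T (\<nu> i) x) \<longlonglongrightarrow> 0"
      using tendsto_real_sqrt[OF elim(1)] by (simp add: tendsto_rabs_zero_iff)
    have dist: "\<bar>a (\<nu> i) x / real (\<nu> i)\<bar> \<le> \<bar>T (\<nu> i) x\<bar> + G (\<nu> i) x" for i
    proof -
      let ?n = "\<nu> i"
      have dec: "E j (W j) x = E j (Z ?n j) x + E j (V ?n j) x" for j
        using elim(3) by blast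
      have "a ?n x = (\<Sum>j<?n. Z ?n j x - E j (Z ?n j) x) + (\<Sum>j<?n. V ?n j x - E j (V ?n j) x)"
        unfolding a_def sum.distrib[symmetric]
        by (intro sum.cong refl) (simp add: V_def dec)
      moreover have "\<bar>\<Sum>j<?n. V ?n j x - E j (V ?n j) x\<bar> \<le> (\<Sum>j<?n. V ?n j x + E j (V ?n j) x)"
        by (rule order_trans[OF sum_abs], rule sum_mono)
           (use V0 elim(3) in \<open>force simp: abs_le_iff\<close>)
      ultimately have "\<bar>a ?n x\<bar> / ?n \<le> (\<bar>\<Sum>j<?n. Z ?n j x - E j (Z ?n j) x\<bar> + (\<Sum>j<?n. V ?n j x + E j (V ?n j) x)) / ?n"
        by (intro divide_right_mono) auto
      then show ?thesis by (simp add: T_def G_def add_divide_distrib)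
    qed
    have "(\<lambda>i. a (\<nu> i) x / real (\<nu> i)) \<longlonglongrightarrow> 0"
    proof (rule Lim_null_comparison)
      show "\<forall>\<^sub>F i in sequentially. norm (a (\<nu> i) x / real (\<nu> i)) \<le> \<bar>T (\<nu> i) x\<bar> + G (\<nu> i) x"
        using dist by simp
      show "(\<lambda>i. \<bar>T (\<nu> i) x\<bar> + G (\<nu> i) x) \<longlonglongrightarrow> 0"
        using \<open>(\<lambda>i. T (\<nu> i) x) \<longlonglongrightarrow> 0\<close> elim(2) by (intro tendsto_add_zero tendsto_rabs_zero)
    qed
    moreover have "mono (\<lambda>n. a n x + B * real n)"
      unfolding mono_iff_le_Suc
    proof
      fix n
      have "E n (W n) x \<le> B" "0 \<le> W n x" using elim(3) nn by auto
      then show "a n x + B * real n \<le> a (Suc n) x + B * real (Suc n)"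
        by (simp add: a_def algebra_simps)
    qed
    ultimately have "(\<lambda>n. a n x / real n) \<longlonglongrightarrow> 0"
      using \<open>0 \<le> B\<close> \<nu> ratio by (intro tendsto_zero_from_slow_subsequence[of _ B \<nu>])
    then show ?case by (simp add: a_def E_def)
  qed
qed

end

section \<open>Conditional expectation given the past, from a transition kernel\<close>

text \<open>
The assumption \<open>law\<close> is a one-step transition: coordinate \<open>i\<close> is drawn from the kernel \<open>\<kappa>\<close>, evaluated
at the coordinates in \<open>I\<close>.  Boxes suffice to state it, as they determine the law of finitely many coordinates.
\<close>

context
  fixes J :: "('i \<Rightarrow> 'e) measure" and E :: "'e measure" and I L :: "'i set" and i :: 'i
    and \<kappa> :: "('i \<Rightarrow> 'e) \<Rightarrow> 'e measure"
  assumes J: "prob_space J" and sets_J: "sets J = sets (PiM L (\<lambda>_. E))"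
    and I: "finite I" "i \<notin> I" "insert i I \<subseteq> L"
    and \<kappa>: "\<kappa> \<in> PiM I (\<lambda>_. E) \<rightarrow>\<^sub>M prob_algebra E"
    and law: "\<And>A. (\<And>l. l \<in> insert i I \<Longrightarrow> A l \<in> sets E) \<Longrightarrow>
      emeasure J {x \<in> space J. \<forall>l\<in>insert i I. x l \<in> A l}
      = (\<integral>\<^sup>+x. indicator {x \<in> space J. \<forall>l\<in>I. x l \<in> A l} x * emeasure (\<kappa> (restrict x I)) (A i) \<partial>J)"
begin

text \<open>
The joint law of the coordinates in \<open>insert i I\<close> and the composition of the law of those in \<open>I\<close> with the
kernel agree on boxes, hence everywhere, since \<open>I\<close> is finite.  The integral formula is Fubini's
theorem for that composition.
\<close>

lemma nn_integral_one_step: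
  assumes f: "f \<in> borel_measurable (PiM (insert i I) (\<lambda>_. E))"
  shows "(\<integral>\<^sup>+x. f (restrict x (insert i I)) \<partial>J)
    = (\<integral>\<^sup>+x. (\<integral>\<^sup>+u. f ((restrict x I)(i := u)) \<partial>\<kappa> (restrict x I)) \<partial>J)"
proof -
  interpret J: prob_space J by (rule J)
  let ?I = "PiM I (\<lambda>_. E)" and ?I' = "PiM (insert i I) (\<lambda>_. E)"
  let ?\<rho> = "\<lambda>x. restrict x I" and ?\<rho>' = "\<lambda>x. restrict x (insert i I)"
  \<comment> \<open>\<open>T z\<close> keeps the history \<open>z\<close> and appends a fresh draw.\<close>
  define T where "T z = distr (\<kappa> z) ?I' (\<lambda>u. z(i := u))" for z
  have \<rho>: "?\<rho> \<in> J \<rightarrow>\<^sub>M ?I" and \<rho>': "?\<rho>' \<in> J \<rightarrow>\<^sub>M ?I'"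
    using I measurable_restrict_subset[of _ L "\<lambda>_. E"]
    by (auto simp: measurable_cong_sets[OF sets_J refl])
  have T: "T \<in> ?I \<rightarrow>\<^sub>M prob_algebra ?I'"
    unfolding T_def by (rule measurable_distr_prob_space2[OF \<kappa> measurable_add_dim])
  have T': "T \<in> distr J ?I ?\<rho> \<rightarrow>\<^sub>M subprob_algebra ?I'"
    using measurable_prob_algebraD[OF T] by simp
  have ne: "space (distr J ?I ?\<rho>) \<noteq> {}"
    by (metis J.not_empty measurable_space[OF \<rho>] all_not_in_conv space_distr)
  have sp: "space E = space (\<kappa> z)" "sets (\<kappa> z) = sets E" if "z \<in> space ?I" for z
    using measurable_space[OF \<kappa> that] sets_eq_imp_space_eq[of "\<kappa> z" E]
    by (auto simp: space_prob_algebra)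
  have upd: "(\<lambda>u. z(i := u)) \<in> \<kappa> z \<rightarrow>\<^sub>M ?I'" if z: "z \<in> space ?I" for z
    using measurable_compose[OF measurable_Pair1'[OF z] measurable_add_dim[of i I "\<lambda>_. E"]]
    by (simp add: measurable_cong_sets[OF sp(2)[OF z] refl])
  have eq: "distr J ?I' ?\<rho>' = distr J ?I ?\<rho> \<bind> T"
  proof (rule measure_eqI_PiM_finite[where A="\<lambda>_. space ?I'"])
    show "sets (distr J ?I ?\<rho> \<bind> T) = sets ?I'"
      using T' ne by (rule sets_bind_measurable)
    show "range (\<lambda>_. space ?I') \<subseteq> prod_algebra (insert i I) (\<lambda>_. E)"
      using I(1) by (auto simp: space_PiM intro!: prod_algebraI_finite)
    interpret D: prob_space "distr J ?I' ?\<rho>'" by (rule J.prob_space_distr[OF \<rho>'])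
    show "emeasure (distr J ?I' ?\<rho>') (space ?I') \<noteq> \<infinity>" for k :: nat by simp
    fix A assume A: "\<And>l. l \<in> insert i I \<Longrightarrow> A l \<in> sets E"
    have box: "Pi\<^sub>E (insert i I) A \<in> sets ?I'"
      using A I(1) by (intro sets_PiM_I_finite) auto
    have "emeasure (distr J ?I ?\<rho> \<bind> T) (Pi\<^sub>E (insert i I) A)
        = (\<integral>\<^sup>+z. emeasure (T z) (Pi\<^sub>E (insert i I) A) \<partial>distr J ?I ?\<rho>)"
      by (rule emeasure_bind[OF ne T' box])
    also have "\<dots> = (\<integral>\<^sup>+x. emeasure (T (?\<rho> x)) (Pi\<^sub>E (insert i I) A) \<partial>J)"
      using measurable_emeasure_kernel[OF measurable_prob_algebraD[OF T] box]
      by (intro nn_integral_distr[OF \<rho>]) simp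
    also have "\<dots> = (\<integral>\<^sup>+x. indicator {x \<in> space J. \<forall>l\<in>I. x l \<in> A l} x * emeasure (\<kappa> (?\<rho> x)) (A i) \<partial>J)"
    proof (rule nn_integral_cong)
      fix x assume x: "x \<in> space J"
      then have z: "?\<rho> x \<in> space ?I" by (rule measurable_space[OF \<rho>])
      have "(\<lambda>u. (?\<rho> x)(i := u)) -` Pi\<^sub>E (insert i I) A \<inter> space (\<kappa> (?\<rho> x))
          = (if \<forall>l\<in>I. x l \<in> A l then A i else {})"
        using I(2) sets.sets_into_space[OF A[of i]] sp[OF z]
        by (auto simp: PiE_iff extensional_def split: if_splits)
      then show "emeasure (T (?\<rho> x)) (Pi\<^sub>E (insert i I) A)
          = indicator {x \<in> space J. \<forall>l\<in>I. x l \<in> A l} x * emeasure (\<kappa> (?\<rho> x)) (A i)"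
        using x unfolding T_def by (subst emeasure_distr[OF upd[OF z] box]) auto
    qed
    also have "\<dots> = emeasure J {x \<in> space J. \<forall>l\<in>insert i I. x l \<in> A l}"
      by (rule law[symmetric]) (use A in auto)
    also have "\<dots> = emeasure (distr J ?I' ?\<rho>') (Pi\<^sub>E (insert i I) A)"
      by (subst emeasure_distr[OF \<rho>' box]) (auto intro!: arg_cong2[where f=emeasure] simp: PiE_iff)
    finally show "emeasure (distr J ?I' ?\<rho>') (Pi\<^sub>E (insert i I) A)
        = emeasure (distr J ?I ?\<rho> \<bind> T) (Pi\<^sub>E (insert i I) A)" ..
  qed (use I in auto)
  have "(\<integral>\<^sup>+x. f (?\<rho>' x) \<partial>J) = (\<integral>\<^sup>+y. f y \<partial>distr J ?I' ?\<rho>')"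
    by (rule nn_integral_distr[OF \<rho>', symmetric]) (simp add: f)
  also have "\<dots> = (\<integral>\<^sup>+z. \<integral>\<^sup>+y. f y \<partial>T z \<partial>distr J ?I ?\<rho>)"
    unfolding eq by (rule nn_integral_bind[OF f T'])
  also have "\<dots> = (\<integral>\<^sup>+x. \<integral>\<^sup>+y. f y \<partial>T (?\<rho> x) \<partial>J)"
    using measurable_compose[OF measurable_prob_algebraD[OF T] nn_integral_measurable_subprob_algebra[OF f]]
    by (intro nn_integral_distr[OF \<rho>]) simp
  also have "\<dots> = (\<integral>\<^sup>+x. (\<integral>\<^sup>+u. f ((?\<rho> x)(i := u)) \<partial>\<kappa> (?\<rho> x)) \<partial>J)"
    unfolding T_def
    by (intro nn_integral_cong nn_integral_distr[OF upd] measurable_space[OF \<rho>]) (simp_all add: f)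
  finally show ?thesis .
qed

text \<open>
Freezing lemma: the conditional expectation given the past is obtained by fixing the past and
integrating the fresh coordinate against the kernel.  The indicator of an event of the past does not
see the fresh coordinate and so passes through the inner integral.
\<close>

lemma cond_exp_one_step:
  assumes g: "g \<in> borel_measurable (PiM (insert i I) (\<lambda>_. E))" and nn: "\<And>z. 0 \<le> g z"
    and bound: "\<And>z. z \<in> space (PiM I (\<lambda>_. E)) \<Longrightarrow> (\<integral>\<^sup>+u. ennreal (g (z(i := u))) \<partial>\<kappa> z) \<le> ennreal c"
    and "0 \<le> c"
  shows "integrable J (\<lambda>x. g (restrict x (insert i I)))" (is ?int)
    and "(\<integral>x. g (restrict x (insert i I)) \<partial>J) \<le> c" (is ?le)
    and "AE x in J. real_cond_exp J (vimage_algebra (space J) (\<lambda>x. restrict x I) (PiM I (\<lambda>_. E)))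
        (\<lambda>x. g (restrict x (insert i I))) x
      = (\<integral>u. g ((restrict x I)(i := u)) \<partial>\<kappa> (restrict x I))" (is ?ce)
proof -
  interpret J: prob_space J by (rule J)
  let ?I = "PiM I (\<lambda>_. E)" and ?I' = "PiM (insert i I) (\<lambda>_. E)"
  let ?\<rho> = "\<lambda>x. restrict x I" and ?\<rho>' = "\<lambda>x. restrict x (insert i I)"
  let ?F = "vimage_algebra (space J) ?\<rho> ?I"
  define m where "m z = (\<integral>u. g (z(i := u)) \<partial>\<kappa> z)" for z
  have \<rho>: "?\<rho> \<in> J \<rightarrow>\<^sub>M ?I" and \<rho>': "?\<rho>' \<in> J \<rightarrow>\<^sub>M ?I'"
    using I measurable_restrict_subset[of _ L "\<lambda>_. E"]
    by (auto simp: measurable_cong_sets[OF sets_J refl])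
  have gM [measurable]: "(\<lambda>x. g (?\<rho>' x)) \<in> borel_measurable J"
    by (rule measurable_compose[OF \<rho>' g])
  have sub: "subalgebra J ?F"
    unfolding subalgebra_def using sets_image_in_sets[OF refl \<rho>] by simp
  interpret finite_measure_subalgebra J ?F
    by (intro finite_measure_subalgebra.intro finite_measure_subalgebra_axioms.intro sub J.finite_measure_axioms)
  have upd: "(\<lambda>u. z(i := u)) \<in> \<kappa> z \<rightarrow>\<^sub>M ?I'" if z: "z \<in> space ?I" for z
  proof -
    have eq: "sets (\<kappa> z) = sets E"
      using measurable_space[OF \<kappa> z] by (simp add: space_prob_algebra)
    show ?thesis
      using measurable_compose[OF measurable_Pair1'[OF z] measurable_add_dim[of i I "\<lambda>_. E"]]
      by (simp add: measurable_cong_sets[OF eq refl])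
  qed
  have nn_m: "(\<integral>\<^sup>+u. ennreal (g (z(i := u))) \<partial>\<kappa> z) = ennreal (m z)" if z: "z \<in> space ?I" for z
  proof -
    have "integrable (\<kappa> z) (\<lambda>u. g (z(i := u)))"
      using measurable_compose[OF upd[OF z] g] bound[OF z] nn
      by (intro integrableI_bounded) (auto simp: le_less_trans)
    then show ?thesis
      unfolding m_def using nn by (intro nn_integral_eq_integral) auto
  qed
  have m_le: "m z \<le> c" "0 \<le> m z" if z: "z \<in> space ?I" for z
    using nn_m[OF z] bound[OF z] \<open>0 \<le> c\<close> nn by (auto simp: m_def)
  have m: "m \<in> borel_measurable ?I"
  proof -
    have "(\<lambda>z. \<integral>\<^sup>+u. ennreal (g (z(i := u))) \<partial>\<kappa> z) \<in> borel_measurable ?I"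
      using measurable_compose[OF measurable_add_dim[of i I "\<lambda>_. E"] g]
      by (intro nn_integral_measurable_subprob_algebra2[OF _ measurable_prob_algebraD[OF \<kappa>]])
         (simp add: case_prod_beta')
    then have "(\<lambda>z. enn2real (\<integral>\<^sup>+u. ennreal (g (z(i := u))) \<partial>\<kappa> z)) \<in> borel_measurable ?I" by measurable
    then show ?thesis
      by (rule measurable_cong[THEN iffD1, rotated]) (simp add: nn_m m_le)
  qed
  have key: "(\<integral>\<^sup>+x. ennreal (indicator A0 (?\<rho> x) * g (?\<rho>' x)) \<partial>J)
      = (\<integral>\<^sup>+x. ennreal (indicator A0 (?\<rho> x) * m (?\<rho> x)) \<partial>J)" if A0: "A0 \<in> sets ?I" for A0
  proof -
    let ?f = "\<lambda>z. ennreal (indicator A0 (?\<rho> z) * g z)"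
    have [measurable]: "?\<rho> \<in> ?I' \<rightarrow>\<^sub>M ?I" by (rule measurable_restrict_subset) auto
    have f: "?f \<in> borel_measurable ?I'" using A0 g by measurable
    have "(\<integral>\<^sup>+x. ennreal (indicator A0 (?\<rho> x) * g (?\<rho>' x)) \<partial>J) = (\<integral>\<^sup>+x. ?f (?\<rho>' x) \<partial>J)"
      by (simp add: Int_absorb1 subset_insertI)
    also have "\<dots> = (\<integral>\<^sup>+x. (\<integral>\<^sup>+u. ?f ((?\<rho> x)(i := u)) \<partial>\<kappa> (?\<rho> x)) \<partial>J)"
      by (rule nn_integral_one_step[OF f])
    also have "\<dots> = (\<integral>\<^sup>+x. ennreal (indicator A0 (?\<rho> x) * m (?\<rho> x)) \<partial>J)"
    proof (rule nn_integral_cong)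
      fix x assume "x \<in> space J"
      then have z: "?\<rho> x \<in> space ?I" by (rule measurable_space[OF \<rho>])
      have "?\<rho> ((?\<rho> x)(i := u)) = ?\<rho> x" for u
        using I(2) by (auto simp: restrict_def)
      then show "(\<integral>\<^sup>+u. ?f ((?\<rho> x)(i := u)) \<partial>\<kappa> (?\<rho> x)) = ennreal (indicator A0 (?\<rho> x) * m (?\<rho> x))"
        using nn_m[OF z] by (simp split: split_indicator)
    qed
    finally show ?thesis .
  qed
  have mJ [measurable]: "(\<lambda>x. m (?\<rho> x)) \<in> borel_measurable J" by (rule measurable_compose[OF \<rho> m])
  have mint: "integrable J (\<lambda>x. m (?\<rho> x))"
    by (rule J.integrable_const_bound[where B=c]) (use m_le measurable_space[OF \<rho>] in \<open>auto intro!: AE_I2\<close>)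
  have all: "(\<integral>\<^sup>+x. ennreal (g (?\<rho>' x)) \<partial>J) = (\<integral>\<^sup>+x. ennreal (m (?\<rho> x)) \<partial>J)"
  proof -
    have "(\<integral>\<^sup>+x. ennreal (g (?\<rho>' x)) \<partial>J) = (\<integral>\<^sup>+x. ennreal (indicator (space ?I) (?\<rho> x) * g (?\<rho>' x)) \<partial>J)"
      by (intro nn_integral_cong) (use measurable_space[OF \<rho>] in simp)
    also have "\<dots> = (\<integral>\<^sup>+x. ennreal (indicator (space ?I) (?\<rho> x) * m (?\<rho> x)) \<partial>J)"
      by (rule key) simp
    also have "\<dots> = (\<integral>\<^sup>+x. ennreal (m (?\<rho> x)) \<partial>J)"
      by (intro nn_integral_cong) (use measurable_space[OF \<rho>] in simp)
    finally show ?thesis .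
  qed
  have all_le: "(\<integral>\<^sup>+x. ennreal (m (?\<rho> x)) \<partial>J) \<le> ennreal c"
  proof -
    have "(\<integral>\<^sup>+x. ennreal (m (?\<rho> x)) \<partial>J) \<le> (\<integral>\<^sup>+x. ennreal c \<partial>J)"
      by (intro nn_integral_mono ennreal_leI m_le measurable_space[OF \<rho>])
    then show ?thesis by (simp add: J.emeasure_space_1)
  qed
  show int: ?int
    using all all_le nn by (intro integrableI_bounded) (auto simp: le_less_trans)
  show ?le
    using nn_integral_eq_integral[OF int] all all_le nn \<open>0 \<le> c\<close> by simp
  show ?ce
    unfolding m_def[symmetric]
  proof (rule real_cond_exp_charact[OF _ int mint])
    show "(\<lambda>x. m (?\<rho> x)) \<in> borel_measurable ?F"
      by (rule measurable_compose[OF measurable_vimage_algebra1 m]) (use measurable_space[OF \<rho>] in auto)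
    fix A assume "A \<in> sets ?F"
    then obtain A0 where A0: "A0 \<in> sets ?I" "A = ?\<rho> -` A0 \<inter> space J"
      using measurable_space[OF \<rho>] by (auto simp: sets_vimage_algebra2)
    have ind: "indicator A x = (indicator A0 (?\<rho> x) :: real)" if "x \<in> space J" for x
      using A0 that by (auto split: split_indicator)
    have AJ [measurable]: "A \<in> sets J" using measurable_sets[OF \<rho> A0(1)] A0(2) by simp
    have "(\<integral>x\<in>A. g (?\<rho>' x) \<partial>J) = enn2real (\<integral>\<^sup>+x. ennreal (indicator A x * g (?\<rho>' x)) \<partial>J)"
      unfolding set_lebesgue_integral_def by (simp add: integral_eq_nn_integral nn)
    also have "(\<integral>\<^sup>+x. ennreal (indicator A x * g (?\<rho>' x)) \<partial>J) = (\<integral>\<^sup>+x. ennreal (indicator A x * m (?\<rho> x)) \<partial>J)"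
      using key[OF A0(1)] by (simp add: ind cong: nn_integral_cong)
    also have "enn2real \<dots> = (\<integral>x\<in>A. m (?\<rho> x) \<partial>J)"
      unfolding set_lebesgue_integral_def
      by (subst integral_eq_nn_integral) (use m_le measurable_space[OF \<rho>] in \<open>auto intro!: AE_I2\<close>)
    finally show "(\<integral>x\<in>A. g (?\<rho>' x) \<partial>J) = (\<integral>x\<in>A. m (?\<rho> x) \<partial>J)" .
  qed
qed

end

section \<open>Change of measure by a density off the zeros of the integrand\<close>

text \<open>
Let \<open>\<rho>\<close> and \<open>q\<close> be the laws of \<open>X\<close> under \<open>P\<close> and \<open>Q\<close>, and let \<open>d0\<close> be the density, set to zero where \<open>h\<close>
vanishes.  The measure with density \<open>d0\<close> relative to \<open>\<rho>\<close> is the restriction of \<open>q\<close> to the set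
where \<open>h\<close> does not vanish, and outside this set \<open>h\<close> contributes nothing.  Equality of these measures needs
\<open>d0\<close> to be non-negative almost surely, which holds since its integrals over all sets are
probabilities.
\<close>

lemma density_off_zeros_change_of_measure:
  assumes Q: "prob_space Q" and X: "X \<in> Q \<rightarrow>\<^sub>M E" and h: "h \<in> borel_measurable E"
    and P: "prob_space P" "sets P = sets Q" and dens: "density_off_zeros Q E X h P d"
  shows "(\<lambda>e. h e * d e) \<in> borel_measurable E"
    and "(\<integral>\<omega>. h (X \<omega>) * d (X \<omega>) \<partial>P) = (\<integral>\<omega>. h (X \<omega>) \<partial>Q)"
proof -
  interpret Q: prob_space Q by (rule Q)
  interpret P: prob_space P by (rule P)
  define H where "H = {e \<in> space E. h e \<noteq> 0}"
  define d0 where "d0 e = indicator H e * d e" for e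
  have [measurable]: "h \<in> borel_measurable E" by (rule h)
  have H [measurable]: "H \<in> sets E" unfolding H_def by measurable
  have XP [measurable]: "X \<in> P \<rightarrow>\<^sub>M E" using X by (simp add: measurable_cong_sets[OF P(2) refl])
  have "{e. h e \<noteq> 0} \<inter> space E = H" by (auto simp: H_def)
  then have "(\<lambda>e. indicator {e. h e \<noteq> 0} e *\<^sub>R d e) \<in> borel_measurable E"
    using dens H borel_measurable_restrict_space_iff[of "{e. h e \<noteq> 0}" E d]
    by (simp add: density_off_zeros_def)
  then have d0 [measurable]: "d0 \<in> borel_measurable E"
    by (rule measurable_cong[THEN iffD1, rotated]) (simp add: d0_def H_def indicator_def)
  have hd: "h e * d e = d0 e * h e" if "e \<in> space E" for e
    using that by (cases "h e = 0") (simp_all add: d0_def H_def)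
  show "(\<lambda>e. h e * d e) \<in> borel_measurable E"
    by (rule measurable_cong[THEN iffD2, of E _ "\<lambda>e. d0 e * h e"]) (simp_all add: hd)
  define \<rho> where "\<rho> = distr P E X"
  define q where "q = distr Q E X"
  interpret \<rho>: prob_space \<rho> unfolding \<rho>_def by (rule P.prob_space_distr) simp
  interpret q: prob_space q unfolding q_def by (rule Q.prob_space_distr[OF X])
  have sets [measurable_cong]: "sets \<rho> = sets E" "sets q = sets E" by (auto simp: \<rho>_def q_def)
  have d0int: "integrable \<rho> (\<lambda>e. indicator B e * d0 e)"
    and mass: "(\<integral>e. indicator B e * d0 e \<partial>\<rho>) = measure q (B \<inter> H)" if B: "B \<in> sets E" for B
  proof -
    have [measurable]: "B \<in> sets E" by (rule B)
    have BH: "B \<inter> H \<in> sets E" "B \<inter> H \<subseteq> {e. h e \<noteq> 0}" by (auto simp: H_def)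
    have eq: "indicator (B \<inter> H) e * d e = indicator B e * d0 e" for e
      by (simp add: d0_def indicator_def)
    have *: "integrable P (\<lambda>\<omega>. indicator B (X \<omega>) * d0 (X \<omega>))"
      "measure Q (X -` (B \<inter> H) \<inter> space Q) = (\<integral>\<omega>. indicator B (X \<omega>) * d0 (X \<omega>) \<partial>P)"
      using dens BH unfolding density_off_zeros_def eq[symmetric] by blast+
    show "integrable \<rho> (\<lambda>e. indicator B e * d0 e)"
      unfolding \<rho>_def using *(1) by (subst integrable_distr_eq) auto
    show "(\<integral>e. indicator B e * d0 e \<partial>\<rho>) = measure q (B \<inter> H)"
      unfolding \<rho>_def q_def using *(2) BH X by (subst integral_distr) (auto simp: measure_distr)
  qed
  have sp: "space \<rho> = space E" by (simp add: \<rho>_def)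
  have "integrable \<rho> (\<lambda>e. indicator (space E) e * d0 e) \<longleftrightarrow> integrable \<rho> d0"
    by (rule Bochner_Integration.integrable_cong) (simp_all add: sp)
  then have "integrable \<rho> d0"
    using d0int[OF sets.top] by blast
  then have pos: "AE e in \<rho>. 0 \<le> d0 e"
  proof (rule \<rho>.density_nonneg)
    fix B assume "B \<in> sets \<rho>"
    then have "B \<in> sets E" by (simp only: sets)
    then show "0 \<le> (\<integral>e\<in>B. d0 e \<partial>\<rho>)"
      using mass[of B] by (simp add: set_lebesgue_integral_def)
  qed
  have eq: "density \<rho> (\<lambda>e. ennreal (d0 e)) = density q (\<lambda>e. ennreal (indicator H e))"
  proof (rule measure_eqI)
    fix B assume "B \<in> sets (density \<rho> (\<lambda>e. ennreal (d0 e)))"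
    then have B [measurable]: "B \<in> sets E" by (simp add: sets)
    have "emeasure (density \<rho> (\<lambda>e. ennreal (d0 e))) B = (\<integral>\<^sup>+e. ennreal (indicator B e * d0 e) \<partial>\<rho>)"
      by (subst emeasure_density) (auto intro!: nn_integral_cong simp: indicator_def sets)
    also have "\<dots> = ennreal (measure q (B \<inter> H))"
      unfolding mass[OF B, symmetric]
      by (rule nn_integral_eq_integral[OF d0int[OF B]]) (use pos in \<open>auto simp: indicator_def\<close>)
    also have "\<dots> = emeasure (density q (\<lambda>e. ennreal (indicator H e))) B"
      by (simp add: ennreal_indicator emeasure_restricted sets q.emeasure_eq_measure Int_commute)
    finally show "emeasure (density \<rho> (\<lambda>e. ennreal (d0 e))) B
      = emeasure (density q (\<lambda>e. ennreal (indicator H e))) B" .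
  qed (simp add: sets)
  have "(\<integral>\<omega>. h (X \<omega>) * d (X \<omega>) \<partial>P) = (\<integral>\<omega>. d0 (X \<omega>) * h (X \<omega>) \<partial>P)"
    by (intro Bochner_Integration.integral_cong refl hd measurable_space[OF XP])
  also have "\<dots> = (\<integral>e. d0 e * h e \<partial>\<rho>)"
    unfolding \<rho>_def by (subst integral_distr) auto
  also have "\<dots> = (\<integral>e. h e \<partial>density \<rho> (\<lambda>e. ennreal (d0 e)))"
    using pos by (subst integral_density) auto
  also have "\<dots> = (\<integral>e. indicator H e * h e \<partial>q)"
    unfolding eq by (subst integral_density) auto
  also have "\<dots> = (\<integral>e. h e \<partial>q)"
    by (intro Bochner_Integration.integral_cong) (auto simp: H_def q_def indicator_def)
  also have "\<dots> = (\<integral>\<omega>. h (X \<omega>) \<partial>Q)"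
    unfolding q_def using X by (subst integral_distr) auto
  finally show "(\<integral>\<omega>. h (X \<omega>) * d (X \<omega>) \<partial>P) = (\<integral>\<omega>. h (X \<omega>) \<partial>Q)" .
qed

section \<open>The samples in order of generation\<close>

text \<open>
The samples in order of generation, counted from zero: position \<open>j\<close> lies in the first iteration whose
cumulative sample size exceeds \<open>j\<close>.  Iterations without samples are skipped by this choice.
\<close>

definition batch_of :: "(nat \<Rightarrow> nat) \<Rightarrow> nat \<Rightarrow> nat" where
  "batch_of N j = (LEAST k. j < (\<Sum>l=1..k. N l))"

definition sample_at :: "(nat \<Rightarrow> nat) \<Rightarrow> nat \<Rightarrow> nat \<times> nat" where
  "sample_at N j = (batch_of N j, Suc (j - (\<Sum>l=1..batch_of N j - 1. N l)))"

lemma sample_at_eq: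
  assumes "n < N (Suc k)"
  shows "sample_at N ((\<Sum>l=1..k. N l) + n) = (Suc k, Suc n)"
proof -
  have "batch_of N ((\<Sum>l=1..k. N l) + n) = Suc k"
    unfolding batch_of_def
  proof (rule Least_equality)
    show "(\<Sum>l=1..k. N l) + n < (\<Sum>l=1..Suc k. N l)" using assms by simp
    fix m assume m: "(\<Sum>l=1..k. N l) + n < (\<Sum>l=1..m. N l)"
    show "Suc k \<le> m"
    proof (rule ccontr)
      assume "\<not> Suc k \<le> m"
      then have "(\<Sum>l=1..m. N l) \<le> (\<Sum>l=1..k. N l)" by (intro sum_mono2) auto
      with m show False by simp
    qed
  qed
  then show ?thesis by (simp add: sample_at_def)
qed

text \<open>
As the total sample size is unbounded, the enumeration never runs out of samples.
\<close>

lemma position_cases: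
  fixes j :: nat
  assumes "filterlim (\<lambda>k. \<Sum>l=1..k. N l) at_top sequentially"
  obtains k n :: nat where "n < N (Suc k)" "j = (\<Sum>l=1..k. N l) + n"
proof -
  let ?P = "\<lambda>k. j < (\<Sum>l=1..k. N l)"
  have "eventually ?P sequentially"
    using assms unfolding filterlim_at_top by (auto simp: Suc_le_eq dest: spec[of _ "Suc j"])
  then obtain k0 where "?P k0" by (auto simp: eventually_sequentially)
  then have P: "?P (Least ?P)" by (rule LeastI[of ?P])
  then obtain k where k: "Least ?P = Suc k" by (cases "Least ?P") auto
  have "\<not> ?P k" by (rule not_less_Least[of _ ?P]) (simp only: k lessI)
  with P k show ?thesis by (intro that[of "j - (\<Sum>l=1..k. N l)" k]) auto
qed

lemma sum_over_positions:
  fixes f :: "nat \<times> nat \<Rightarrow> 'b::comm_monoid_add"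
  shows "(\<Sum>j<(\<Sum>l=1..k. N l). f (sample_at N j)) = (\<Sum>l=1..k. \<Sum>n=1..N l. f (l, n))"
proof (induction k)
  case (Suc k)
  have add: "(\<Sum>j<a + b. g j) = (\<Sum>j<a. g j) + (\<Sum>n<b. g (a + n))" for g :: "nat \<Rightarrow> 'b" and a b
    by (induction b) (simp_all add: add.assoc)
  have "(\<Sum>j<(\<Sum>l=1..Suc k. N l). f (sample_at N j))
      = (\<Sum>j<(\<Sum>l=1..k. N l) + N (Suc k). f (sample_at N j))" by simp
  also have "\<dots> = (\<Sum>l=1..k. \<Sum>n=1..N l. f (l, n)) + (\<Sum>n<N (Suc k). f (Suc k, Suc n))"
    unfolding add Suc.IH
    by (intro arg_cong2[where f="(+)"] sum.cong refl) (simp only: sample_at_eq lessThan_iff)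
  also have "(\<Sum>n<N (Suc k). f (Suc k, Suc n)) = (\<Sum>n=1..N (Suc k). f (Suc k, n))"
    by (simp add: sum.atLeast1_atMost_eq)
  finally show ?case by simp
qed simp

lemma samples_before:
  "n \<le> N (Suc k) \<Longrightarrow>
    sample_at N ` {..<(\<Sum>l=1..k. N l) + n} = earlier_indices N (Suc k) \<union> {Suc k} \<times> {1..n}"
proof (induction k arbitrary: n)
  case 0
  then show ?case
  proof (induction n)
    case (Suc n)
    then show ?case using sample_at_eq[of n N 0]
      by (auto simp: lessThan_Suc atLeastAtMostSuc_conv)
  qed (auto simp: earlier_indices_def)
next
  case (Suc k)
  from Suc.prems show ?case
  proof (induction n)
    case 0
    have "{1..<Suc (Suc k)} = insert (Suc k) {1..<Suc k}" by auto
    then have "earlier_indices N (Suc (Suc k)) = earlier_indices N (Suc k) \<union> {Suc k} \<times> {1..N (Suc k)}"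
      by (auto simp: earlier_indices_def)
    with Suc.IH[of "N (Suc k)"] show ?case by simp
  next
    case (Suc n)
    then show ?case using sample_at_eq[of n N "Suc k"]
      by (simp add: lessThan_Suc atLeastAtMostSuc_conv)
  qed
qed


section \<open>Adaptive sampling, one sample at a time\<close>

text \<open>
The sampling scheme describes the law of a whole batch given the earlier iterations; here it is
turned into the transition for the single sample \<open>Suc n\<close> of the batch, given the earlier iterations and the
first \<open>n\<close> samples of the same batch.  For a box both sides equal the expectation, over the part of the
box that concerns earlier iterations, of the product of the probabilities of the first \<open>Suc n\<close> factors of
the batch.  On the left this is the conditional law of the batch; on the right one factor is
already explicit and the others come from the conditional law with that factor and all later ones trivial.
\<close>

lemma adaptive_sampling_one_step:
  assumes X: "X \<in> Q \<rightarrow>\<^sub>M E"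
    and samp: "adaptive_sampling Q E X \<P> N Prop J" and n: "n < N (Suc k)"
  defines "I \<equiv> earlier_indices N (Suc k) \<union> {Suc k} \<times> {1..n}"
    and "\<kappa> \<equiv> \<lambda>z. distr (Prop (Suc k) (earlier_samples N (Suc k) z)) E X"
  assumes A: "\<And>l. l \<in> insert (Suc k, Suc n) I \<Longrightarrow> A l \<in> sets E"
  shows "\<kappa> \<in> PiM I (\<lambda>_. E) \<rightarrow>\<^sub>M prob_algebra E"
    and "emeasure J {x \<in> space J. \<forall>l\<in>insert (Suc k, Suc n) I. x l \<in> A l}
      = (\<integral>\<^sup>+x. indicator {x \<in> space J. \<forall>l\<in>I. x l \<in> A l} x
          * emeasure (\<kappa> (restrict x I)) (A (Suc k, Suc n)) \<partial>J)"
proof -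
  let ?k = "Suc k" and ?i = "(Suc k, Suc n)"
  let ?e = "earlier_samples N ?k" and ?Y = "earlier_space N E ?k"
  let ?F = "vimage_algebra (space J) ?e ?Y"
  let ?p = "\<lambda>y B. measure (Prop ?k y) (X -` B \<inter> space Q)"
  interpret J: prob_space J using samp by (simp add: adaptive_sampling_def)
  note samp' = samp[unfolded adaptive_sampling_def, THEN conjunct2]
  have sets_J: "sets J = sets (PiM (sample_indices N) (\<lambda>_. E))"
    by (rule samp'[THEN conjunct1])
  have "1 \<le> ?k" by simp
  note step = samp'[THEN conjunct2, THEN spec[of _ ?k], THEN mp, OF \<open>1 \<le> ?k\<close>]
  have Prop: "Prop ?k \<in> ?Y \<rightarrow>\<^sub>M prob_algebra Q"
    by (rule step[THEN conjunct1])
  have cond: "AE x in J. real_cond_exp J ?F (indicator {x \<in> space J. \<forall>n\<in>{1..N ?k}. x (?k, n) \<in> B n}) x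
      = (\<Prod>n=1..N ?k. ?p (?e x) (B n))" if "\<And>n. n \<in> {1..N ?k} \<Longrightarrow> B n \<in> sets E" for B
    by (rule step[THEN conjunct2, THEN conjunct2, THEN spec[of _ B], THEN mp]) (use that in blast)
  have sub: "earlier_indices N ?k \<subseteq> I" "I \<subseteq> sample_indices N" "earlier_indices N ?k \<subseteq> sample_indices N"
    "finite I" "insert ?i I \<subseteq> sample_indices N" "finite (earlier_indices N ?k)"
    using n by (auto simp: I_def earlier_indices_def sample_indices_def)
  have e: "?e \<in> J \<rightarrow>\<^sub>M ?Y" and eI: "?e \<in> PiM I (\<lambda>_. E) \<rightarrow>\<^sub>M ?Y"
    using measurable_restrict_subset[OF sub(3), of "\<lambda>_. E"] measurable_restrict_subset[OF sub(1), of "\<lambda>_. E"]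
    by (auto simp: measurable_cong_sets[OF sets_J refl] earlier_samples_def[abs_def] earlier_space_def)
  have comp: "x l \<in> space E" if "x \<in> space J" "l \<in> sample_indices N" for x l
    using that sets_eq_imp_space_eq[OF sets_J] by (auto simp: space_PiM)
  have pred: "(\<lambda>x. x l) \<in> J \<rightarrow>\<^sub>M E" if "l \<in> sample_indices N" for l
    using that by (simp add: measurable_cong_sets[OF sets_J refl])
  have P: "prob_space (Prop ?k y)" "sets (Prop ?k y) = sets Q" "space (Prop ?k y) = space Q"
    "X \<in> Prop ?k y \<rightarrow>\<^sub>M E" if "y \<in> space ?Y" for y
  proof -
    show 1: "prob_space (Prop ?k y)" "sets (Prop ?k y) = sets Q"
      using measurable_space[OF Prop that] by (auto simp: space_prob_algebra)
    show "space (Prop ?k y) = space Q" using 1(2) by (rule sets_eq_imp_space_eq)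
    show "X \<in> Prop ?k y \<rightarrow>\<^sub>M E" using X by (simp add: measurable_cong_sets[OF 1(2) refl])
  qed
  have K: "(\<lambda>y. distr (Prop ?k y) E X) \<in> ?Y \<rightarrow>\<^sub>M prob_algebra E"
    by (rule measurable_compose[OF Prop measurable_distr_prob_space[OF X]])
  show "\<kappa> \<in> PiM I (\<lambda>_. E) \<rightarrow>\<^sub>M prob_algebra E"
    unfolding \<kappa>_def by (rule measurable_compose[OF eI K])
  have p_eq: "emeasure (distr (Prop ?k y) E X) B = ennreal (?p y B)"
    if y: "y \<in> space ?Y" and B: "B \<in> sets E" for y B
  proof -
    interpret P: prob_space "Prop ?k y" by (rule P[OF y])
    show ?thesis using emeasure_distr[OF P(4)[OF y] B] P(3)[OF y] by (simp add: P.emeasure_eq_measure)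
  qed
  have p1: "?p y (space E) = 1" if y: "y \<in> space ?Y" for y
  proof -
    interpret P: prob_space "Prop ?k y" by (rule P[OF y])
    have "X -` space E \<inter> space Q = space (Prop ?k y)"
      using measurable_space[OF X] P(3)[OF y] by auto
    then show ?thesis by (simp add: P.prob_space)
  qed
  have p_le: "?p y B \<le> 1" if "y \<in> space ?Y" for y B
    using prob_space.prob_le_1[OF P(1)[OF that]] .
  have p_meas: "(\<lambda>y. ?p y B) \<in> borel_measurable ?Y" if B: "B \<in> sets E" for B
  proof -
    have "(\<lambda>y. emeasure (distr (Prop ?k y) E X) B) \<in> borel_measurable ?Y"
      by (rule measurable_emeasure_kernel[OF measurable_prob_algebraD[OF K] B])
    then have "(\<lambda>y. enn2real (emeasure (distr (Prop ?k y) E X) B)) \<in> borel_measurable ?Y" by measurable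
    then show ?thesis
      by (rule measurable_cong[THEN iffD1, rotated]) (simp add: p_eq B)
  qed
  have subalg: "subalgebra J ?F"
    unfolding subalgebra_def using sets_image_in_sets[OF refl e] by simp
  interpret finite_measure_subalgebra J ?F
    by (intro finite_measure_subalgebra.intro finite_measure_subalgebra_axioms.intro subalg J.finite_measure_axioms)
  \<comment> \<open>The defining property of conditional expectation, tested with a bounded function of the earlier samples.\<close>
  have pull: "(\<integral>\<^sup>+x. ennreal (H (?e x) * indicator {x \<in> space J. \<forall>m\<in>{1..N ?k}. x (?k, m) \<in> B m} x) \<partial>J)
      = ennreal (\<integral>x. H (?e x) * (\<Prod>m=1..N ?k. ?p (?e x) (B m)) \<partial>J)"
    if H: "H \<in> borel_measurable ?Y" and H01: "\<And>y. y \<in> space ?Y \<Longrightarrow> 0 \<le> H y \<and> H y \<le> 1"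
      and B: "\<And>m. m \<in> {1..N ?k} \<Longrightarrow> B m \<in> sets E" for H :: "_ \<Rightarrow> real" and B
  proof -
    let ?S = "{x \<in> space J. \<forall>m\<in>{1..N ?k}. x (?k, m) \<in> B m}"
    have "{x \<in> space J. x (?k, m) \<in> B m} \<in> sets J" if "m \<in> {1..N ?k}" for m
      using measurable_sets[OF pred B[OF that]] that
      by (auto simp: vimage_def Int_def conj_commute sample_indices_def)
    then have S [measurable]: "?S \<in> sets J"
      by (intro sets.sets_Collect_finite_All) auto
    have He [measurable]: "(\<lambda>x. H (?e x)) \<in> borel_measurable J" by (rule measurable_compose[OF e H])
    have HF: "(\<lambda>x. H (?e x)) \<in> borel_measurable ?F"
      by (rule measurable_compose[OF measurable_vimage_algebra1 H]) (use measurable_space[OF e] in auto)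
    have b: "0 \<le> H (?e x) \<and> H (?e x) \<le> 1" if "x \<in> space J" for x
      by (rule H01[OF measurable_space[OF e that]])
    have int: "integrable J (\<lambda>x. H (?e x) * indicator ?S x)"
    proof (rule J.integrable_const_bound[where B=1])
      show "AE x in J. norm (H (?e x) * indicator ?S x) \<le> 1"
        by (rule AE_I2) (use b in \<open>simp add: indicator_def\<close>)
    qed (rule borel_measurable_times[OF He borel_measurable_indicator[OF S]])
    have "(\<integral>\<^sup>+x. ennreal (H (?e x) * indicator ?S x) \<partial>J) = ennreal (\<integral>x. H (?e x) * indicator ?S x \<partial>J)"
      by (rule nn_integral_eq_integral[OF int]) (use b in \<open>auto intro!: AE_I2\<close>)
    also have "(\<integral>x. H (?e x) * indicator ?S x \<partial>J) = (\<integral>x. H (?e x) * real_cond_exp J ?F (indicator ?S) x \<partial>J)"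
      by (rule real_cond_exp_intg(2)[OF int HF borel_measurable_indicator[OF S], symmetric])
    also have "\<dots> = (\<integral>x. H (?e x) * (\<Prod>m=1..N ?k. ?p (?e x) (B m)) \<partial>J)"
    proof (rule integral_cong_AE)
      have "(\<lambda>x. ?p (?e x) (B m)) \<in> borel_measurable J" if "m \<in> {1..N ?k}" for m
        by (rule measurable_compose[OF e p_meas[OF B[OF that]]])
      then show "(\<lambda>x. H (?e x) * (\<Prod>m=1..N ?k. ?p (?e x) (B m))) \<in> borel_measurable J"
        by (intro borel_measurable_times He borel_measurable_prod) auto
      have "AE x in J. real_cond_exp J ?F (indicator ?S) x = (\<Prod>m=1..N ?k. ?p (?e x) (B m))"
        by (rule cond) (rule B)
      then show "AE x in J. H (?e x) * real_cond_exp J ?F (indicator ?S) x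
          = H (?e x) * (\<Prod>m=1..N ?k. ?p (?e x) (B m))" by eventually_elim simp
    qed simp
    finally show ?thesis .
  qed
  \<comment> \<open>The sides of the box within the batch, with and without the sample \<open>Suc n\<close>; the later samples are unconstrained.\<close>
  define B where "B m = (if m \<le> Suc n then A (?k, m) else space E)" for m
  define B' where "B' m = (if m \<le> n then A (?k, m) else space E)" for m
  define U where "U = {y \<in> space ?Y. \<forall>l\<in>earlier_indices N ?k. y l \<in> A l}"
  have A_I: "A ?i \<in> sets E" "\<And>m. m \<in> {1..Suc n} \<Longrightarrow> A (?k, m) \<in> sets E"
    "\<And>l. l \<in> earlier_indices N ?k \<Longrightarrow> A l \<in> sets E"
    using A by (auto simp: I_def le_Suc_eq)
  have B: "B m \<in> sets E" "B' m \<in> sets E" if "m \<in> {1..N ?k}" for m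
    using A_I(2) that by (auto simp: B_def B'_def)
  have U: "U \<in> sets ?Y"
    unfolding U_def
  proof (intro sets.sets_Collect_finite_All sub)
    fix l assume l: "l \<in> earlier_indices N ?k"
    have "(\<lambda>y. y l) \<in> ?Y \<rightarrow>\<^sub>M E" using l by (simp add: earlier_space_def)
    from measurable_sets[OF this A_I(3)[OF l]] show "{y \<in> space ?Y. y l \<in> A l} \<in> sets ?Y"
      by (simp add: vimage_def Int_def conj_commute)
  qed
  have eU: "?e x \<in> U \<longleftrightarrow> (\<forall>l\<in>earlier_indices N ?k. x l \<in> A l)" if "x \<in> space J" for x
    using measurable_space[OF e that] by (auto simp: U_def earlier_samples_def)
  have inE: "x (?k, m) \<in> space E" if "x \<in> space J" "m \<in> {1..N ?k}" for x m
    using comp[OF that(1)] that(2) by (auto simp: sample_indices_def)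
  have batch: "(\<forall>l\<in>insert ?i I. x l \<in> A l) \<longleftrightarrow> ?e x \<in> U \<and> (\<forall>m\<in>{1..N ?k}. x (?k, m) \<in> B m)"
    "(\<forall>l\<in>I. x l \<in> A l) \<longleftrightarrow> ?e x \<in> U \<and> (\<forall>m\<in>{1..N ?k}. x (?k, m) \<in> B' m)" if x: "x \<in> space J" for x
  proof -
    have "(\<forall>m\<in>{1..N ?k}. x (?k, m) \<in> B m) \<longleftrightarrow> (\<forall>m\<in>{1..Suc n}. x (?k, m) \<in> A (?k, m))"
      using inE[OF x] n by (auto simp: B_def)
    then show "(\<forall>l\<in>insert ?i I. x l \<in> A l) \<longleftrightarrow> ?e x \<in> U \<and> (\<forall>m\<in>{1..N ?k}. x (?k, m) \<in> B m)"
      using eU[OF x] by (auto simp: I_def le_Suc_eq)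
    have "(\<forall>m\<in>{1..N ?k}. x (?k, m) \<in> B' m) \<longleftrightarrow> (\<forall>m\<in>{1..n}. x (?k, m) \<in> A (?k, m))"
      using inE[OF x] n by (auto simp: B'_def)
    then show "(\<forall>l\<in>I. x l \<in> A l) \<longleftrightarrow> ?e x \<in> U \<and> (\<forall>m\<in>{1..N ?k}. x (?k, m) \<in> B' m)"
      using eU[OF x] by (auto simp: I_def)
  qed
  have prods: "(\<Prod>m=1..N ?k. ?p y (B m)) = ?p y (A ?i) * (\<Prod>m=1..N ?k. ?p y (B' m))"
    if y: "y \<in> space ?Y" for y
  proof -
    have Sn: "Suc n \<in> {1..N ?k}" using n by auto
    have rest: "(\<Prod>m\<in>{1..N ?k} - {Suc n}. ?p y (B m)) = (\<Prod>m\<in>{1..N ?k} - {Suc n}. ?p y (B' m))"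
      by (intro prod.cong refl arg_cong[where f="?p y"]) (auto simp: B_def B'_def)
    show ?thesis
      unfolding prod.remove[OF finite_atLeastAtMost Sn] rest
      using p1[OF y] by (simp add: B_def B'_def)
  qed
  let ?H = "\<lambda>y. indicator U y :: real" and ?H' = "\<lambda>y. indicator U y * ?p y (A ?i)"
  have "emeasure J {x \<in> space J. \<forall>l\<in>insert ?i I. x l \<in> A l}
      = (\<integral>\<^sup>+x. indicator {x \<in> space J. \<forall>l\<in>insert ?i I. x l \<in> A l} x \<partial>J)"
  proof (rule nn_integral_indicator[symmetric], rule sets.sets_Collect_finite_All)
    fix l assume l: "l \<in> insert ?i I"
    then have "l \<in> sample_indices N" using sub(5) by auto
    from measurable_sets[OF pred[OF this] A[OF l]] show "{x \<in> space J. x l \<in> A l} \<in> sets J"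
      by (simp add: vimage_def Int_def conj_commute)
  qed (use sub(4) in simp)
  also have "\<dots> = (\<integral>\<^sup>+x. ennreal (?H (?e x) * indicator {x \<in> space J. \<forall>m\<in>{1..N ?k}. x (?k, m) \<in> B m} x) \<partial>J)"
    by (intro nn_integral_cong) (use batch(1) in \<open>simp add: indicator_def\<close>)
  also have "\<dots> = ennreal (\<integral>x. ?H (?e x) * (\<Prod>m=1..N ?k. ?p (?e x) (B m)) \<partial>J)"
    by (rule pull) (use U B in \<open>auto simp: indicator_def\<close>)
  also have "\<dots> = ennreal (\<integral>x. ?H' (?e x) * (\<Prod>m=1..N ?k. ?p (?e x) (B' m)) \<partial>J)"
    by (intro arg_cong[where f=ennreal] Bochner_Integration.integral_cong refl)
       (simp only: prods[OF measurable_space[OF e]] mult.assoc)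
  also have "\<dots> = (\<integral>\<^sup>+x. ennreal (?H' (?e x) * indicator {x \<in> space J. \<forall>m\<in>{1..N ?k}. x (?k, m) \<in> B' m} x) \<partial>J)"
    by (rule pull[symmetric])
       (use U B p_le p_meas[OF A_I(1)] in \<open>auto simp: indicator_def\<close>)
  also have "\<dots> = (\<integral>\<^sup>+x. indicator {x \<in> space J. \<forall>l\<in>I. x l \<in> A l} x
          * emeasure (\<kappa> (restrict x I)) (A ?i) \<partial>J)"
  proof (rule nn_integral_cong)
    fix x assume x: "x \<in> space J"
    have "earlier_samples N ?k (restrict x I) = ?e x"
      using sub(1) by (auto simp: earlier_samples_def fun_eq_iff restrict_def)
    then have "emeasure (\<kappa> (restrict x I)) (A ?i) = ennreal (?p (?e x) (A ?i))"
      unfolding \<kappa>_def using p_eq[OF measurable_space[OF e x] A_I(1)] by simp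
    then show "ennreal (?H' (?e x) * indicator {x \<in> space J. \<forall>m\<in>{1..N ?k}. x (?k, m) \<in> B' m} x)
      = indicator {x \<in> space J. \<forall>l\<in>I. x l \<in> A l} x * emeasure (\<kappa> (restrict x I)) (A ?i)"
      using batch(2)[OF x] x by (simp add: indicator_def)
  qed
  finally show "emeasure J {x \<in> space J. \<forall>l\<in>insert ?i I. x l \<in> A l}
      = (\<integral>\<^sup>+x. indicator {x \<in> space J. \<forall>l\<in>I. x l \<in> A l} x
          * emeasure (\<kappa> (restrict x I)) (A ?i) \<partial>J)" .
qed

section \<open>Consistency of the estimator\<close>

locale flat_amis =
  fixes Q :: "'a measure" and E :: "'e measure" and X :: "'a \<Rightarrow> 'e" and h :: "'e \<Rightarrow> real"
    and \<P> :: "'a measure set" and dens :: "'a measure \<Rightarrow> 'e \<Rightarrow> real" and r C :: real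
    and N :: "nat \<Rightarrow> nat" and Prop :: "nat \<Rightarrow> (nat \<times> nat \<Rightarrow> 'e) \<Rightarrow> 'a measure"
    and J :: "(nat \<times> nat \<Rightarrow> 'e) measure"
  assumes Q: "prob_space Q" and X: "X \<in> Q \<rightarrow>\<^sub>M E" and h: "h \<in> borel_measurable E"
    and proposal: "\<And>P. P \<in> \<P> \<Longrightarrow> prob_space P \<and> sets P = sets Q"
    and density: "\<And>P. P \<in> \<P> \<Longrightarrow> density_off_zeros Q E X h P (dens P)"
    and r: "r > 1"
    and moment: "\<And>P. P \<in> \<P> \<Longrightarrow>
           integrable P (\<lambda>\<omega>. \<bar>h (X \<omega>) * dens P (X \<omega>)\<bar> powr r) \<and>
           (\<integral>\<omega>. \<bar>h (X \<omega>) * dens P (X \<omega>)\<bar> powr r \<partial>P) powr (1 / r) < C"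
    and sampling: "adaptive_sampling Q E X \<P> N Prop J"
    and weight_measurable: "\<And>k n. k \<ge> 1 \<Longrightarrow> n \<in> {1..N k} \<Longrightarrow>
           amis_weight h dens N Prop k n \<in> borel_measurable J"
    and unbounded: "filterlim (\<lambda>k. \<Sum>l=1..k. N l) at_top sequentially"
begin

definition history :: "nat \<Rightarrow> (nat \<times> nat) set" where
  "history j = sample_at N ` {..<j}"

definition history_algebra :: "nat \<Rightarrow> (nat \<times> nat \<Rightarrow> 'e) measure" where
  "history_algebra j =
    vimage_algebra (space J) (\<lambda>x. restrict x (history j)) (PiM (history j) (\<lambda>_. E))"

definition weight_at :: "nat \<Rightarrow> (nat \<times> nat \<Rightarrow> 'e) \<Rightarrow> real" where
  "weight_at j = amis_weight h dens N Prop (fst (sample_at N j)) (snd (sample_at N j))"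

definition proposal_at :: "nat \<Rightarrow> (nat \<times> nat \<Rightarrow> 'e) \<Rightarrow> 'a measure" where
  "proposal_at j x = (let k = fst (sample_at N j) in Prop k (earlier_samples N k x))"

lemma prob_J: "prob_space J" and sets_J: "sets J = sets (PiM (sample_indices N) (\<lambda>_. E))"
  using sampling by (auto simp: adaptive_sampling_def)

lemma Prop_in_class: "y \<in> space (earlier_space N E (Suc k)) \<Longrightarrow> Prop (Suc k) y \<in> \<P>"
  using sampling by (auto simp: adaptive_sampling_def)

lemma history_at_position:
  assumes "n < N (Suc k)" "j = (\<Sum>l=1..k. N l) + n"
  shows "history j = earlier_indices N (Suc k) \<union> {Suc k} \<times> {1..n}"
    and "sample_at N j = (Suc k, Suc n)"
    and "history (Suc j) = insert (Suc k, Suc n) (history j)"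
  unfolding history_def assms(2)
  using samples_before[of n N k] sample_at_eq[of n N k, OF assms(1)] assms(1) by (simp_all add: lessThan_Suc)

lemma history_subset: "history j \<subseteq> sample_indices N" and finite_history: "finite (history j)"
  and next_not_in_history: "sample_at N j \<notin> history j"
proof -
  obtain k n where p: "n < N (Suc k)" "j = (\<Sum>l=1..k. N l) + n"
    by (rule position_cases[OF unbounded])
  show "history j \<subseteq> sample_indices N" "finite (history j)" "sample_at N j \<notin> history j"
    using p(1) by (auto simp: history_at_position[OF p] earlier_indices_def sample_indices_def)
qed

lemma history_measurable: "(\<lambda>x. restrict x (history j)) \<in> J \<rightarrow>\<^sub>M PiM (history j) (\<lambda>_. E)"
  using measurable_restrict_subset[OF history_subset, where M="\<lambda>_. E"]
  by (simp add: measurable_cong_sets[OF sets_J refl])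

text \<open>
The past grows with the position, because restricting to fewer samples factors through restricting to more.
\<close>

lemma filtered_prob_space_history: "filtered_prob_space J history_algebra"
proof (intro filtered_prob_space.intro filtered_prob_space_axioms.intro prob_J)
  show "subalgebra J (history_algebra n)" for n
    unfolding subalgebra_def history_algebra_def
    using sets_image_in_sets[OF refl history_measurable] by simp
  fix m n :: nat assume "m \<le> n"
  then have sub: "history m \<subseteq> history n" by (auto simp: history_def)
  show "sets (history_algebra m) \<subseteq> sets (history_algebra n)"
    unfolding history_algebra_def
  proof (rule sets_image_in_sets)
    let ?N = "vimage_algebra (space J) (\<lambda>x. restrict x (history n)) (PiM (history n) (\<lambda>_. E))"
    have "(\<lambda>x. restrict x (history n)) \<in> ?N \<rightarrow>\<^sub>M PiM (history n) (\<lambda>_. E)"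
      by (rule measurable_vimage_algebra1) (use measurable_space[OF history_measurable] in auto)
    from measurable_compose[OF this measurable_restrict_subset[OF sub]]
    show "(\<lambda>x. restrict x (history m)) \<in> ?N \<rightarrow>\<^sub>M PiM (history m) (\<lambda>_. E)"
      using sub by (simp add: Int_absorb1)
  qed simp
qed

lemma weight_at_restrict: "weight_at j (restrict x (history (Suc j))) = weight_at j x"
proof -
  obtain k n where p: "n < N (Suc k)" "j = (\<Sum>l=1..k. N l) + n"
    by (rule position_cases[OF unbounded])
  have "earlier_samples N (Suc k) (restrict x (history (Suc j))) = earlier_samples N (Suc k) x"
    by (auto simp: earlier_samples_def fun_eq_iff history_at_position[OF p])
  then show ?thesis
    by (simp add: weight_at_def amis_weight_def history_at_position[OF p])
qed

text \<open>
Measurability of the weights is given with respect to the array of all samples.  A weight only looks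
at samples up to its own position, so filling the other entries with those of a fixed
array leaves it unchanged and exhibits it as a measurable function of these samples alone.
\<close>

lemma weight_at_measurable_history:
  "weight_at j \<in> borel_measurable (PiM (history (Suc j)) (\<lambda>_. E))"
proof -
  interpret J: prob_space J by (rule prob_J)
  obtain k n where p: "n < N (Suc k)" "j = (\<Sum>l=1..k. N l) + n"
    by (rule position_cases[OF unbounded])
  obtain x0 where x0: "x0 \<in> space J" using J.not_empty by blast
  let ?S = "sample_indices N" and ?H = "history (Suc j)"
  \<comment> \<open>An array that agrees with \<open>z\<close> up to position \<open>j\<close> and with \<open>x0\<close> afterwards.\<close>
  define ext where "ext z = (\<lambda>l\<in>?S. if l \<in> ?H then z l else x0 l)" for z
  have x0E: "x0 l \<in> space E" if "l \<in> ?S" for l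
    using x0 that sets_eq_imp_space_eq[OF sets_J] by (auto simp: space_PiM)
  have "ext \<in> PiM ?H (\<lambda>_. E) \<rightarrow>\<^sub>M PiM ?S (\<lambda>_. E)"
    unfolding ext_def
  proof (rule measurable_restrict)
    fix l assume "l \<in> ?S"
    then show "(\<lambda>z. if l \<in> ?H then z l else x0 l) \<in> PiM ?H (\<lambda>_. E) \<rightarrow>\<^sub>M E"
      by (cases "l \<in> ?H") (auto simp: x0E)
  qed
  moreover have "weight_at j \<in> borel_measurable (PiM ?S (\<lambda>_. E))"
    using weight_measurable[of "Suc k" "Suc n"] p(1)
    by (simp add: weight_at_def history_at_position[OF p] measurable_cong_sets[OF sets_J refl])
  ultimately have "(\<lambda>z. weight_at j (ext z)) \<in> borel_measurable (PiM ?H (\<lambda>_. E))"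
    by (rule measurable_compose)
  moreover have "weight_at j (ext z) = weight_at j z" for z
  proof -
    have "restrict (ext z) ?H = restrict z ?H"
      using history_subset[of "Suc j"] by (auto simp: ext_def fun_eq_iff restrict_def)
    then show ?thesis using weight_at_restrict by metis
  qed
  ultimately show ?thesis by simp
qed

lemma weight_at_adapted: "weight_at j \<in> borel_measurable (history_algebra (Suc j))"
proof -
  have "(\<lambda>x. restrict x (history (Suc j))) \<in> history_algebra (Suc j) \<rightarrow>\<^sub>M PiM (history (Suc j)) (\<lambda>_. E)"
    unfolding history_algebra_def
    by (rule measurable_vimage_algebra1) (use measurable_space[OF history_measurable] in auto)
  from measurable_compose[OF this weight_at_measurable_history] show ?thesis
    by (simp add: weight_at_restrict)
qed

text \<open>
The bound is uniform over the class of proposals; adaptivity then does no harm, whichever proposal is selected.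
\<close>

lemma weight_moments_under_proposal:
  assumes P: "P \<in> \<P>" and \<phi> [measurable]: "\<phi> \<in> borel_measurable borel"
    and le: "\<And>w. \<bar>\<phi> w\<bar> \<le> 1 + \<bar>w\<bar> powr r"
  shows "integrable P (\<lambda>\<omega>. \<phi> (h (X \<omega>) * dens P (X \<omega>)))"
    and "(\<integral>\<omega>. \<phi> (h (X \<omega>) * dens P (X \<omega>)) \<partial>P) \<le> 1 + C powr r"
proof -
  interpret P: prob_space P using proposal[OF P] by simp
  let ?w = "\<lambda>\<omega>. h (X \<omega>) * dens P (X \<omega>)"
  have sets_P: "sets P = sets Q" using proposal[OF P] by simp
  have "X \<in> P \<rightarrow>\<^sub>M E" using X by (simp add: measurable_cong_sets[OF sets_P refl])
  from measurable_compose[OF this density_off_zeros_change_of_measure(1)[OF Q X h P.prob_space_axioms sets_P density[OF P]]]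
  have [measurable]: "?w \<in> borel_measurable P" .
  have I: "integrable P (\<lambda>\<omega>. 1 + \<bar>?w \<omega>\<bar> powr r)" using moment[OF P] by simp
  show int: "integrable P (\<lambda>\<omega>. \<phi> (?w \<omega>))"
  proof (rule Bochner_Integration.integrable_bound[OF I])
    show "AE \<omega> in P. norm (\<phi> (?w \<omega>)) \<le> norm (1 + \<bar>?w \<omega>\<bar> powr r)"
    proof (rule AE_I2)
      fix \<omega>
      have "0 \<le> 1 + \<bar>?w \<omega>\<bar> powr r" by (simp add: add_nonneg_nonneg)
      then show "norm (\<phi> (?w \<omega>)) \<le> norm (1 + \<bar>?w \<omega>\<bar> powr r)" using le[of "?w \<omega>"] by simp
    qed
  qed simp
  let ?m = "\<integral>\<omega>. \<bar>?w \<omega>\<bar> powr r \<partial>P"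
  have "0 \<le> ?m" by simp
  then have "?m = (?m powr (1 / r)) powr r" using r by (simp add: powr_powr)
  also have "\<dots> \<le> C powr r" using moment[OF P] r by (intro powr_mono2) auto
  finally have m: "?m \<le> C powr r" .
  have "(\<integral>\<omega>. \<phi> (?w \<omega>) \<partial>P) \<le> (\<integral>\<omega>. 1 + \<bar>?w \<omega>\<bar> powr r \<partial>P)"
    using le by (intro integral_mono int I) (meson abs_le_D1)
  also have "\<dots> = 1 + ?m" using moment[OF P] by (simp add: P.prob_space)
  finally show "(\<integral>\<omega>. \<phi> (?w \<omega>) \<partial>P) \<le> 1 + C powr r" using m by simp
qed

lemma proposal_at_in_class: "x \<in> space J \<Longrightarrow> proposal_at j x \<in> \<P>"
proof -
  assume x: "x \<in> space J"
  obtain k n where p: "n < N (Suc k)" "j = (\<Sum>l=1..k. N l) + n"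
    by (rule position_cases[OF unbounded])
  have "earlier_indices N (Suc k) \<subseteq> sample_indices N"
    by (auto simp: earlier_indices_def sample_indices_def)
  then have "earlier_samples N (Suc k) x \<in> space (earlier_space N E (Suc k))"
    using x sets_eq_imp_space_eq[OF sets_J]
    by (auto simp: earlier_samples_def earlier_space_def space_PiM)
  then show ?thesis
    using Prop_in_class by (simp add: proposal_at_def history_at_position[OF p])
qed

text \<open>
Given the past, the proposal is a fixed member of the class and the next weight is distributed as
\<open>h(X) dens(X)\<close> under it.  The function \<open>\<phi>\<close> stands for the positive part, the negative part or a power of
either.
\<close>

lemma cond_exp_weight:
  assumes \<phi> [measurable]: "\<phi> \<in> borel_measurable borel" and nn: "\<And>w. 0 \<le> \<phi> w"
    and le: "\<And>w. \<phi> w \<le> 1 + \<bar>w\<bar> powr r"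
  shows "integrable J (\<lambda>x. \<phi> (weight_at j x))"
    and "(\<integral>x. \<phi> (weight_at j x) \<partial>J) \<le> 1 + C powr r"
    and "AE x in J. real_cond_exp J (history_algebra j) (\<lambda>x. \<phi> (weight_at j x)) x
      = (\<integral>\<omega>. \<phi> (h (X \<omega>) * dens (proposal_at j x) (X \<omega>)) \<partial>proposal_at j x)"
proof -
  obtain k n where p: "n < N (Suc k)" "j = (\<Sum>l=1..k. N l) + n"
    by (rule position_cases[OF unbounded])
  let ?k = "Suc k" and ?i = "(Suc k, Suc n)"
  define \<kappa> where "\<kappa> z = distr (Prop ?k (earlier_samples N ?k z)) E X" for z
  note hist = history_at_position[OF p]
  have le': "\<bar>\<phi> w\<bar> \<le> 1 + \<bar>w\<bar> powr r" for w using nn le by simp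
  have \<kappa>: "\<kappa> \<in> PiM (history j) (\<lambda>_. E) \<rightarrow>\<^sub>M prob_algebra E"
    using adaptive_sampling_one_step(1)[OF X sampling p(1), of "\<lambda>_. space E"]
    by (simp add: hist(1) \<kappa>_def[abs_def])
  have law: "emeasure J {x \<in> space J. \<forall>l\<in>insert ?i (history j). x l \<in> A l}
      = (\<integral>\<^sup>+x. indicator {x \<in> space J. \<forall>l\<in>history j. x l \<in> A l} x
          * emeasure (\<kappa> (restrict x (history j))) (A ?i) \<partial>J)"
    if "\<And>l. l \<in> insert ?i (history j) \<Longrightarrow> A l \<in> sets E" for A
    using adaptive_sampling_one_step(2)[OF X sampling p(1), of A] that
    unfolding hist(1) \<kappa>_def by blast
  have step: "\<kappa> z = distr P E X" "weight_at j (z(?i := u)) = h u * dens P u"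
    if "P = Prop ?k (earlier_samples N ?k z)" for z u P
  proof -
    show "\<kappa> z = distr P E X" using that by (simp add: \<kappa>_def)
    have "earlier_samples N ?k (z(?i := u)) = earlier_samples N ?k z"
      by (auto simp: earlier_samples_def earlier_indices_def fun_eq_iff restrict_def)
    then show "weight_at j (z(?i := u)) = h u * dens P u"
      using that by (simp add: weight_at_def amis_weight_def hist(2))
  qed
  have P: "Prop ?k (earlier_samples N ?k z) \<in> \<P>" if "z \<in> space (PiM (history j) (\<lambda>_. E))" for z
  proof (rule Prop_in_class)
    have "earlier_indices N ?k \<subseteq> history j" by (auto simp: hist(1))
    then show "earlier_samples N ?k z \<in> space (earlier_space N E ?k)"
      using that by (auto simp: earlier_samples_def earlier_space_def space_PiM)
  qed
  have meas: "(\<lambda>u. \<phi> (h u * dens P u)) \<in> borel_measurable E" "X \<in> P \<rightarrow>\<^sub>M E" if "P \<in> \<P>" for P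
  proof -
    have P: "prob_space P" "sets P = sets Q" using proposal[OF that] by auto
    show "(\<lambda>u. \<phi> (h u * dens P u)) \<in> borel_measurable E"
      by (rule measurable_compose[OF density_off_zeros_change_of_measure(1)[OF Q X h P density[OF that]] \<phi>])
    show "X \<in> P \<rightarrow>\<^sub>M E" using X by (simp add: measurable_cong_sets[OF P(2) refl])
  qed
  have g: "(\<lambda>z. \<phi> (weight_at j z)) \<in> borel_measurable (PiM (insert ?i (history j)) (\<lambda>_. E))"
    using measurable_compose[OF weight_at_measurable_history \<phi>, of j] by (simp add: hist(3))
  have bound: "(\<integral>\<^sup>+u. ennreal (\<phi> (weight_at j (z(?i := u)))) \<partial>\<kappa> z) \<le> ennreal (1 + C powr r)"
    if z: "z \<in> space (PiM (history j) (\<lambda>_. E))" for z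
  proof -
    define P where "P = Prop ?k (earlier_samples N ?k z)"
    have PP: "P \<in> \<P>" unfolding P_def by (rule P[OF z])
    note m = meas[OF PP]
    have "(\<integral>\<^sup>+u. ennreal (\<phi> (weight_at j (z(?i := u)))) \<partial>\<kappa> z)
        = (\<integral>\<^sup>+\<omega>. ennreal (\<phi> (h (X \<omega>) * dens P (X \<omega>))) \<partial>P)"
      unfolding step[OF P_def] using m by (subst nn_integral_distr) auto
    also have "\<dots> = ennreal (\<integral>\<omega>. \<phi> (h (X \<omega>) * dens P (X \<omega>)) \<partial>P)"
      by (rule nn_integral_eq_integral[OF weight_moments_under_proposal(1)[OF PP \<phi> le']]) (simp add: nn)
    also have "\<dots> \<le> ennreal (1 + C powr r)"
      by (rule ennreal_leI[OF weight_moments_under_proposal(2)[OF PP \<phi> le']])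
    finally show ?thesis .
  qed
  have "?i \<notin> history j" "insert ?i (history j) \<subseteq> sample_indices N"
    using next_not_in_history[of j] history_subset[of "Suc j"] by (simp_all add: hist(2,3))
  note new = this
  have c0: "0 \<le> 1 + C powr r" by (simp add: add_nonneg_nonneg)
  have restr: "weight_at j (restrict x (insert ?i (history j))) = weight_at j x" for x
    using weight_at_restrict[of j x] by (simp add: hist(3))
  note one_step = cond_exp_one_step[OF prob_J sets_J finite_history new \<kappa> _ g nn _ c0, unfolded restr]
  show "integrable J (\<lambda>x. \<phi> (weight_at j x))"
    by (rule one_step(1)) (rule law, assumption, rule bound)
  show "(\<integral>x. \<phi> (weight_at j x) \<partial>J) \<le> 1 + C powr r"
    by (rule one_step(2)) (rule law, assumption, rule bound)
  have ae: "AE x in J. real_cond_exp J (history_algebra j) (\<lambda>x. \<phi> (weight_at j x)) x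
      = (\<integral>u. \<phi> (weight_at j ((restrict x (history j))(?i := u))) \<partial>\<kappa> (restrict x (history j)))"
    unfolding history_algebra_def by (rule one_step(3)) (rule law, assumption, rule bound)
  have val: "(\<integral>u. \<phi> (weight_at j ((restrict x (history j))(?i := u))) \<partial>\<kappa> (restrict x (history j)))
      = (\<integral>\<omega>. \<phi> (h (X \<omega>) * dens (proposal_at j x) (X \<omega>)) \<partial>proposal_at j x)" if x: "x \<in> space J" for x
  proof -
    have "earlier_samples N ?k (restrict x (history j)) = earlier_samples N ?k x"
      by (auto simp: earlier_samples_def fun_eq_iff hist(1))
    then have eq: "proposal_at j x = Prop ?k (earlier_samples N ?k (restrict x (history j)))"
      by (simp add: proposal_at_def hist(2))
    note m = meas[OF proposal_at_in_class[OF x], of j]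
    show ?thesis
      unfolding step[OF eq] using m by (subst integral_distr) auto
  qed
  show "AE x in J. real_cond_exp J (history_algebra j) (\<lambda>x. \<phi> (weight_at j x)) x
      = (\<integral>\<omega>. \<phi> (h (X \<omega>) * dens (proposal_at j x) (X \<omega>)) \<partial>proposal_at j x)"
    using ae AE_space by eventually_elim (simp add: val)
qed

text \<open>
The conditional mean of \<open>\<phi>\<close> of a weight depends on the proposal and thus on the past, but it stays bounded.
The exponent is lowered to at most two, as the strong law demands; this is possible since a
smaller power is at most one plus a larger one.
\<close>

lemma strong_law_weight_part:
  assumes \<phi> [measurable]: "\<phi> \<in> borel_measurable borel" and nn: "\<And>w. 0 \<le> \<phi> w"
    and le: "\<And>w. \<phi> w \<le> \<bar>w\<bar>"
  shows "AE x in J. (\<lambda>n. (\<Sum>j<n. \<phi> (weight_at j x)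
      - (\<integral>\<omega>. \<phi> (h (X \<omega>) * dens (proposal_at j x) (X \<omega>)) \<partial>proposal_at j x)) / real n) \<longlonglongrightarrow> 0"
proof -
  interpret filtered_prob_space J history_algebra by (rule filtered_prob_space_history)
  define s where "s = min r 2"
  have s: "1 < s" "s \<le> 2" "s \<le> r" using r by (auto simp: s_def)
  have le1: "\<phi> w \<le> 1 + \<bar>w\<bar> powr r" for w
    using le[of w] le_one_plus_powr[of "\<bar>w\<bar>" 1 r] r by simp
  have les: "\<phi> w powr s \<le> 1 + \<bar>w\<bar> powr r" for w
  proof -
    have "\<phi> w powr s \<le> \<bar>w\<bar> powr s" using s nn le by (intro powr_mono2) auto
    also have "\<dots> \<le> 1 + \<bar>w\<bar> powr r" using s by (intro le_one_plus_powr) auto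
    finally show ?thesis .
  qed
  have \<phi>s: "(\<lambda>w. \<phi> w powr s) \<in> borel_measurable borel" by measurable
  have cond: "AE x in J. real_cond_exp J (history_algebra j) (\<lambda>x. \<phi> (weight_at j x)) x
      = (\<integral>\<omega>. \<phi> (h (X \<omega>) * dens (proposal_at j x) (X \<omega>)) \<partial>proposal_at j x)" for j
    by (rule cond_exp_weight(3)[OF \<phi> nn le1])
  have "AE x in J. (\<lambda>n. (\<Sum>j<n. \<phi> (weight_at j x)
      - real_cond_exp J (history_algebra j) (\<lambda>x. \<phi> (weight_at j x)) x) / real n) \<longlonglongrightarrow> 0"
  proof (rule strong_law_nonneg_adapted[OF _ nn s(1,2)])
    show "(\<lambda>x. \<phi> (weight_at j x)) \<in> borel_measurable (history_algebra (Suc j))" for j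
      by (rule measurable_compose[OF weight_at_adapted \<phi>])
    show "integrable J (\<lambda>x. \<phi> (weight_at j x) powr s)"
      and "(\<integral>x. \<phi> (weight_at j x) powr s \<partial>J) \<le> 1 + C powr r" for j
      using cond_exp_weight(1,2)[OF \<phi>s _ les] by auto
    show "AE x in J. real_cond_exp J (history_algebra j) (\<lambda>x. \<phi> (weight_at j x)) x \<le> 1 + C powr r" for j
      using cond[of j] AE_space
    proof eventually_elim
      case (elim x)
      have "\<bar>\<phi> w\<bar> \<le> 1 + \<bar>w\<bar> powr r" for w using nn le1 by simp
      with weight_moments_under_proposal(2)[OF proposal_at_in_class[OF elim(2)] \<phi>] elim(1)
      show ?case by simp
    qed
    show "0 \<le> 1 + C powr r" by (simp add: add_nonneg_nonneg)
  qed
  moreover have "AE x in J. \<forall>j. real_cond_exp J (history_algebra j) (\<lambda>x. \<phi> (weight_at j x)) x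
      = (\<integral>\<omega>. \<phi> (h (X \<omega>) * dens (proposal_at j x) (X \<omega>)) \<partial>proposal_at j x)"
    using cond by (simp add: AE_all_countable)
  ultimately show ?thesis by eventually_elim simp
qed

text \<open>
The means of the two parts vary with the proposal; their difference does not.
\<close>

lemma proposal_mean_parts:
  assumes P: "P \<in> \<P>"
  shows "(\<integral>\<omega>. max 0 (h (X \<omega>) * dens P (X \<omega>)) \<partial>P) - (\<integral>\<omega>. max 0 (- (h (X \<omega>) * dens P (X \<omega>))) \<partial>P)
    = (\<integral>\<omega>. h (X \<omega>) \<partial>Q)"
proof -
  let ?w = "\<lambda>\<omega>. h (X \<omega>) * dens P (X \<omega>)"
  have b: "\<bar>w\<bar> \<le> 1 + \<bar>w\<bar> powr r" for w :: real
    using le_one_plus_powr[of "\<bar>w\<bar>" 1 r] r by simp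
  have "\<bar>max 0 w\<bar> \<le> 1 + \<bar>w\<bar> powr r" "\<bar>max 0 (- w)\<bar> \<le> 1 + \<bar>w\<bar> powr r" for w :: real
    using b[of w] powr_ge_zero[of "\<bar>w\<bar>" r] by (auto simp: max_def simp del: powr_ge_zero)
  then have "integrable P (\<lambda>\<omega>. max 0 (?w \<omega>))" "integrable P (\<lambda>\<omega>. max 0 (- ?w \<omega>))"
    using weight_moments_under_proposal(1)[OF P, of "max 0"]
      weight_moments_under_proposal(1)[OF P, of "\<lambda>w. max 0 (- w)"] by auto
  then have "(\<integral>\<omega>. max 0 (?w \<omega>) \<partial>P) - (\<integral>\<omega>. max 0 (- ?w \<omega>) \<partial>P)
      = (\<integral>\<omega>. max 0 (?w \<omega>) - max 0 (- ?w \<omega>) \<partial>P)" by simp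
  also have "\<dots> = (\<integral>\<omega>. ?w \<omega> \<partial>P)"
    by (intro Bochner_Integration.integral_cong) auto
  also have "\<dots> = (\<integral>\<omega>. h (X \<omega>) \<partial>Q)"
    using proposal[OF P] by (intro density_off_zeros_change_of_measure(2)[OF Q X h _ _ density[OF P]]) auto
  finally show ?thesis .
qed

text \<open>
The estimator after iteration \<open>k\<close> is the average of the weights at the positions before the end of
batch \<open>k\<close>, so it is a subsequence of the averages over all positions.  The strong law holds for the
positive and the negative parts of the weights, and their conditional means differ by the constant \<open>\<psi>\<close>.
\<close>

theorem flat_amis_consistent:
  "AE x in J. (\<lambda>k. flat_amis_estimator h dens N Prop k x) \<longlonglongrightarrow> (\<integral>\<omega>. h (X \<omega>) \<partial>Q)"
proof -
  define \<psi> where "\<psi> = (\<integral>\<omega>. h (X \<omega>) \<partial>Q)"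
  have pos: "AE x in J. (\<lambda>n. (\<Sum>j<n. max 0 (weight_at j x)
      - (\<integral>\<omega>. max 0 (h (X \<omega>) * dens (proposal_at j x) (X \<omega>)) \<partial>proposal_at j x)) / real n) \<longlonglongrightarrow> 0"
    by (rule strong_law_weight_part) auto
  have neg: "AE x in J. (\<lambda>n. (\<Sum>j<n. max 0 (- weight_at j x)
      - (\<integral>\<omega>. max 0 (- (h (X \<omega>) * dens (proposal_at j x) (X \<omega>))) \<partial>proposal_at j x)) / real n) \<longlonglongrightarrow> 0"
    by (rule strong_law_weight_part[where \<phi>="\<lambda>w. max 0 (- w)"]) auto
  show ?thesis
    using pos neg AE_space
  proof eventually_elim
    case (elim x)
    have summand: "(max 0 (weight_at j x)
        - (\<integral>\<omega>. max 0 (h (X \<omega>) * dens (proposal_at j x) (X \<omega>)) \<partial>proposal_at j x))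
      - (max 0 (- weight_at j x)
        - (\<integral>\<omega>. max 0 (- (h (X \<omega>) * dens (proposal_at j x) (X \<omega>))) \<partial>proposal_at j x))
      = weight_at j x - \<psi>" for j
      using proposal_mean_parts[OF proposal_at_in_class[OF elim(3)], of j] unfolding \<psi>_def by linarith
    have "(\<lambda>n. (\<Sum>j<n. weight_at j x - \<psi>) / real n) \<longlonglongrightarrow> 0"
      using tendsto_diff[OF elim(1,2)]
      unfolding diff_divide_distrib[symmetric] sum_subtractf[symmetric] summand by simp
    then have "(\<lambda>k. (\<Sum>j<(\<Sum>l=1..k. N l). weight_at j x - \<psi>) / real (\<Sum>l=1..k. N l)) \<longlonglongrightarrow> 0"
      by (rule filterlim_compose[OF _ unbounded])
    from tendsto_add[OF this tendsto_const[of \<psi>]]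
    have lim: "(\<lambda>k. (\<Sum>j<(\<Sum>l=1..k. N l). weight_at j x - \<psi>) / real (\<Sum>l=1..k. N l) + \<psi>) \<longlonglongrightarrow> \<psi>"
      by simp
    have "eventually (\<lambda>k. 0 < (\<Sum>l=1..k. N l)) sequentially"
      using unbounded unfolding filterlim_at_top by (auto simp: Suc_le_eq dest: spec[of _ "Suc 0"])
    then have "eventually (\<lambda>k. (\<Sum>j<(\<Sum>l=1..k. N l). weight_at j x - \<psi>) / real (\<Sum>l=1..k. N l) + \<psi>
        = flat_amis_estimator h dens N Prop k x) sequentially"
    proof eventually_elim
      case (elim k)
      have "(\<Sum>l=1..k. \<Sum>n=1..N l. amis_weight h dens N Prop l n x) = (\<Sum>j<(\<Sum>l=1..k. N l). weight_at j x)"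
        using sum_over_positions[of "\<lambda>p. amis_weight h dens N Prop (fst p) (snd p) x" N k]
        by (simp add: weight_at_def)
      moreover have "(\<Sum>j<t. w j - \<psi>) / real t + \<psi> = 1 / real t * (\<Sum>j<t. w j)"
        if "0 < t" for t :: nat and w
        using that by (simp add: sum_subtractf field_simps)
      ultimately show ?case
        using elim unfolding flat_amis_estimator_def by presburger
    qed
    with lim show ?case unfolding \<psi>_def by (rule Lim_transform_eventually)
  qed
qed

end

theorem theorem1:
  fixes Q :: "'a measure" and E :: "'e measure" and X :: "'a \<Rightarrow> 'e" and h :: "'e \<Rightarrow> real"
    and \<P> :: "'a measure set" and dens :: "'a measure \<Rightarrow> 'e \<Rightarrow> real" and r C :: real
    and N :: "nat \<Rightarrow> nat" and Prop :: "nat \<Rightarrow> (nat \<times> nat \<Rightarrow> 'e) \<Rightarrow> 'a measure"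
    and J :: "(nat \<times> nat \<Rightarrow> 'e) measure"
  assumes "prob_space Q"
    and "X \<in> Q \<rightarrow>\<^sub>M E"
    and "h \<in> borel_measurable E"
    and "\<And>P. P \<in> \<P> \<Longrightarrow> prob_space P \<and> sets P = sets Q"
    and "\<And>P. P \<in> \<P> \<Longrightarrow> density_off_zeros Q E X h P (dens P)"
    and "\<And>P A. P \<in> \<P> \<Longrightarrow> A \<in> sets Q \<Longrightarrow> measure P A = 0 \<Longrightarrow>
           (AE \<omega> in Q. \<omega> \<in> A \<longrightarrow> h (X \<omega>) = 0)"
    and "r > 1" and "C > 0"
    and "\<And>P. P \<in> \<P> \<Longrightarrow>
           integrable P (\<lambda>\<omega>. \<bar>h (X \<omega>) * dens P (X \<omega>)\<bar> powr r) \<and>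
           (\<integral>\<omega>. \<bar>h (X \<omega>) * dens P (X \<omega>)\<bar> powr r \<partial>P) powr (1 / r) < C"
    and "adaptive_sampling Q E X \<P> N Prop J"
    and "\<And>k n. k \<ge> 1 \<Longrightarrow> n \<in> {1..N k} \<Longrightarrow>
           amis_weight h dens N Prop k n \<in> borel_measurable J"
    and "filterlim (\<lambda>k. \<Sum>l=1..k. N l) at_top sequentially"
  shows "AE x in J. (\<lambda>k. flat_amis_estimator h dens N Prop k x) \<longlonglongrightarrow> (\<integral>\<omega>. h (X \<omega>) \<partial>Q)"
proof -
  interpret flat_amis Q E X h \<P> dens r C N Prop J
    by (rule flat_amis.intro) (fact assms)+
  show ?thesis by (rule flat_amis_consistent)
qed

end
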